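(* Let $M$ be a compact manifold, $I=[0,T]$, and let $g(t)$, $t\in I$, be a Ricci flow on $M$, i.e. $\partial g/\partial t=-2\,{\rm Ric}_{g}$. Let $\widehat C\in[0,\infty)$ be a constant such that for every smooth family of immersed curves $S^1\times I\to M$ satisfying the curve-shrinking equation in $(M,g(t))_{t\in I}$, $$\frac{\partial}{\partial t}k^2\le (k^2)''-2\langle(\nabla_SH)^\perp,(\nabla_SH)^\perp\rangle+2k^4+\widehat C(k^2+k)$$ on $S^1\times I$, and put $C_1=\widehat C/2$. Let $C_2$ be an upper bound for $|{\rm Ric}_g|$ over $M\times I$. Let $c\colon S^1\times I\to M$ be a smooth family of immersed curves satisfying the curve-shrinking equation $\partial c/\partial t=H$, with total length $L(t)=\int ds$ and total curvature $\Theta(t)=\int k\,ds$ at time $t$. Then for all $t\in I$, $$L(t)\le L(0)e^{C_2t}$$ and $$\Theta(t)\le\Theta(t)+L(t)\le\bigl(\Theta(0)+L(0)\bigr)e^{(C_1+C_2)t}.$$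
   Context: $\nabla^g$ denotes the family of Levi-Civita connections of the metrics $g(t)$ and ${\rm Ric}_g$ their Ricci tensors. For a curve-shrinking flow $c$: $X(x,t)$ is the tangent vector $\partial c/\partial x$, $|X|$ its $g(t)$-length, $S=X/|X|$ the unit tangent field, $H=\nabla^g_SS$ the curvature vector, $k=|H|$, and $ds=|X|\,dx$; thus $L(t)=\int_{S^1}|X|(x,t)\,dx$ and $\Theta(t)=\int_{S^1}k(x,t)|X|(x,t)\,dx$. In the inequality defining $\widehat C$: $\hat g=g(t)+dt^2$ is the metric on $M\times I$ that is the orthogonal sum of the $g(t)$ and the usual metric on $I$; inner products are with respect to $\hat g$; $\nabla$ is its Levi-Civita connection; $S$ and $H$ are regarded as vector fields along the immersion $\hat c(x,t)=(c(x,t),t)$ tangent to the $M$-factor, and $\nabla_S$ is covariant differentiation along $\hat c$ in direction $S$; $\perp$ denotes the component orthogonal to $S$ in $T(M\times I)$; $\partial/\partial t$ is taken at fixed $x$; and $f'=S(f)=|X|^{-1}\partial_xf$. (A constant $\widehat C$ with this property, depending only on the Ricci flow, exists.) *)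

theory Defs
  imports "HOL-Analysis.Analysis"
begin

section \<open>Smooth maps\<close>

text \<open>Derivatives are taken within \<open>S\<close>, so that the definition covers both open sets and
  sets which are relatively open in \<open>E \<times> [0,T]\<close>, where derivatives in the last variable are
  one-sided at the end points. On such sets (with \<open>T > 0\<close>) derivatives are unique.\<close>

primrec Ck_on :: "nat \<Rightarrow> 'a::real_normed_vector set \<Rightarrow> ('a \<Rightarrow> 'b::real_normed_vector) \<Rightarrow> bool" where
  "Ck_on 0 S f \<longleftrightarrow> continuous_on S f"
| "Ck_on (Suc k) S f \<longleftrightarrow>
     (\<exists>D. (\<forall>x\<in>S. (f has_derivative D x) (at x within S)) \<and> (\<forall>v. Ck_on k S (\<lambda>x. D x v)))"

definition smooth_on :: "'a::real_normed_vector set \<Rightarrow> ('a \<Rightarrow> 'b::real_normed_vector) \<Rightarrow> bool" where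
  "smooth_on S f \<longleftrightarrow> (\<forall>k. Ck_on k S f)"


section \<open>Smooth manifolds\<close>

text \<open>A chart is a pair of its domain and its coordinate map into the model space.\<close>

type_synonym ('m, 'e) chart = "'m set \<times> ('m \<Rightarrow> 'e)"

definition chart_dom :: "('m, 'e) chart \<Rightarrow> 'm set" where
  "chart_dom \<kappa> = fst \<kappa>"

definition coord :: "('m, 'e) chart \<Rightarrow> 'm \<Rightarrow> 'e" where
  "coord \<kappa> = snd \<kappa>"

definition chart_img :: "('m, 'e) chart \<Rightarrow> 'e set" where
  "chart_img \<kappa> = coord \<kappa> ` chart_dom \<kappa>"

definition param :: "('m, 'e) chart \<Rightarrow> 'e \<Rightarrow> 'm" where
  "param \<kappa> = inv_into (chart_dom \<kappa>) (coord \<kappa>)"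

definition overlap :: "('m, 'e) chart \<Rightarrow> ('m, 'e) chart \<Rightarrow> 'e set" where
  "overlap \<kappa> \<kappa>' = coord \<kappa> ` (chart_dom \<kappa> \<inter> chart_dom \<kappa>')"

definition transition :: "('m, 'e) chart \<Rightarrow> ('m, 'e) chart \<Rightarrow> 'e \<Rightarrow> 'e" where
  "transition \<kappa> \<kappa>' = coord \<kappa>' \<circ> param \<kappa>"

definition smooth_atlas :: "('m::topological_space, 'e::euclidean_space) chart set \<Rightarrow> bool" where
  "smooth_atlas A \<longleftrightarrow>
     (\<Union>\<kappa>\<in>A. chart_dom \<kappa>) = UNIV \<and>
     (\<forall>\<kappa>\<in>A. open (chart_dom \<kappa>) \<and> open (chart_img \<kappa>) \<and>
        homeomorphism (chart_dom \<kappa>) (chart_img \<kappa>) (coord \<kappa>) (param \<kappa>)) \<and>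
     (\<forall>\<kappa>\<in>A. \<forall>\<kappa>'\<in>A. smooth_on (overlap \<kappa> \<kappa>') (transition \<kappa> \<kappa>'))"

definition chart_at :: "('m, 'e) chart set \<Rightarrow> 'm \<Rightarrow> ('m, 'e) chart" where
  "chart_at A p = (SOME \<kappa>. \<kappa> \<in> A \<and> p \<in> chart_dom \<kappa>)"


section \<open>Riemannian geometry in a coordinate domain\<close>

text \<open>A metric on a subset \<open>S\<close> of the model space is a function \<open>G\<close> sending a point to a bilinear
  form. Connections and curvature are written without choosing a basis: all vectors below are
  coordinate representations, and a fixed vector stands for a constant-coefficient vector field.\<close>

definition inner_product_form :: "('e::real_vector \<Rightarrow> 'e \<Rightarrow> real) \<Rightarrow> bool" where
  "inner_product_form B \<longleftrightarrow>
     bilinear B \<and> (\<forall>u v. B u v = B v u) \<and> (\<forall>u. u \<noteq> 0 \<longrightarrow> B u u > 0)"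

definition dir_deriv ::
    "'e::real_normed_vector set \<Rightarrow> ('e \<Rightarrow> 'b::real_normed_vector) \<Rightarrow> 'e \<Rightarrow> 'e \<Rightarrow> 'b" where
  "dir_deriv S f p u = frechet_derivative f (at p within S) u"

text \<open>Koszul's formula for constant-coefficient fields, whose Lie brackets vanish:
  \<open>christoffel S G p u v\<close> is the value at \<open>p\<close> of the Levi-Civita derivative of \<open>v\<close> along \<open>u\<close>.\<close>

definition christoffel ::
    "'e::euclidean_space set \<Rightarrow> ('e \<Rightarrow> 'e \<Rightarrow> 'e \<Rightarrow> real) \<Rightarrow> 'e \<Rightarrow> 'e \<Rightarrow> 'e \<Rightarrow> 'e" where
  "christoffel S G p u v =
     (THE z. \<forall>w. 2 * G p z w =
        dir_deriv S (\<lambda>q. G q v w) p u + dir_deriv S (\<lambda>q. G q u w) p v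
          - dir_deriv S (\<lambda>q. G q u v) p w)"

definition levi_civita ::
    "'e::euclidean_space set \<Rightarrow> ('e \<Rightarrow> 'e \<Rightarrow> 'e \<Rightarrow> real) \<Rightarrow> 'e \<Rightarrow> ('e \<Rightarrow> 'e) \<Rightarrow> 'e \<Rightarrow> 'e" where
  "levi_civita S G u V p = dir_deriv S V p u + christoffel S G p u (V p)"

definition curvature ::
    "'e::euclidean_space set \<Rightarrow> ('e \<Rightarrow> 'e \<Rightarrow> 'e \<Rightarrow> real) \<Rightarrow> 'e \<Rightarrow> 'e \<Rightarrow> 'e \<Rightarrow> 'e \<Rightarrow> 'e" where
  "curvature S G p u v w =
     levi_civita S G u (levi_civita S G v (\<lambda>_. w)) p
       - levi_civita S G v (levi_civita S G u (\<lambda>_. w)) p"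

text \<open>Trace of \<open>u \<mapsto> R(u,v)w\<close>, positive on round spheres. The trace does not depend on the
  metric, so the standard basis of the model space may be used.\<close>

definition ricci ::
    "'e::euclidean_space set \<Rightarrow> ('e \<Rightarrow> 'e \<Rightarrow> 'e \<Rightarrow> real) \<Rightarrow> 'e \<Rightarrow> 'e \<Rightarrow> 'e \<Rightarrow> real" where
  "ricci S G p v w = (\<Sum>b\<in>Basis. curvature S G p b v w \<bullet> b)"

text \<open>The norm which an inner product \<open>B\<close> induces on bilinear forms, computed in an arbitrary
  \<open>B\<close>-orthonormal frame.\<close>

definition orthonormal_frame ::
    "('e::euclidean_space \<Rightarrow> 'e \<Rightarrow> real) \<Rightarrow> ('e \<Rightarrow> 'e) \<Rightarrow> bool" where
  "orthonormal_frame B e \<longleftrightarrow> (\<forall>i\<in>Basis. \<forall>j\<in>Basis. B (e i) (e j) = (if i = j then 1 else 0))"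

definition tensor_norm ::
    "('e::euclidean_space \<Rightarrow> 'e \<Rightarrow> real) \<Rightarrow> ('e \<Rightarrow> 'e \<Rightarrow> real) \<Rightarrow> real" where
  "tensor_norm B R =
     (let e = (SOME e. orthonormal_frame B e)
      in sqrt (\<Sum>i\<in>Basis. \<Sum>j\<in>Basis. (R (e i) (e j))\<^sup>2))"

text \<open>Covariant derivative at \<open>x\<close> of a vector field \<open>V\<close> along a curve \<open>\<gamma>\<close>, in the direction of
  the velocity of \<open>\<gamma>\<close>.\<close>

definition cov_deriv_along ::
    "'e::euclidean_space set \<Rightarrow> ('e \<Rightarrow> 'e \<Rightarrow> 'e \<Rightarrow> real) \<Rightarrow> (real \<Rightarrow> 'e) \<Rightarrow> (real \<Rightarrow> 'e) \<Rightarrow> real \<Rightarrow> 'e" where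
  "cov_deriv_along S G \<gamma> V x =
     vector_derivative V (at x)
       + christoffel S G (\<gamma> x) (vector_derivative \<gamma> (at x)) (V x)"


section \<open>Ricci flow\<close>

text \<open>A family of metrics on the manifold is given by its coordinate representations:
  \<open>g \<kappa> t q\<close> is the metric at time \<open>t\<close>, in the chart \<open>\<kappa>\<close>, at the point with coordinates \<open>q\<close>.
  The representations are related by the transformation law of covariant 2-tensors.\<close>

type_synonym ('m, 'e) metrics = "('m, 'e) chart \<Rightarrow> real \<Rightarrow> 'e \<Rightarrow> 'e \<Rightarrow> 'e \<Rightarrow> real"

definition smooth_metrics ::
    "('m, 'e::euclidean_space) chart set \<Rightarrow> real set \<Rightarrow> ('m, 'e) metrics \<Rightarrow> bool" where
  "smooth_metrics A I g \<longleftrightarrow>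
     (\<forall>\<kappa>\<in>A. \<forall>t\<in>I. \<forall>q\<in>chart_img \<kappa>. inner_product_form (g \<kappa> t q)) \<and>
     (\<forall>\<kappa>\<in>A. \<forall>u v. smooth_on (chart_img \<kappa> \<times> I) (\<lambda>(q, t). g \<kappa> t q u v)) \<and>
     (\<forall>\<kappa>\<in>A. \<forall>\<kappa>'\<in>A. \<forall>t\<in>I. \<forall>q\<in>overlap \<kappa> \<kappa>'. \<forall>u v.
        g \<kappa> t q u v =
          g \<kappa>' t (transition \<kappa> \<kappa>' q)
            (dir_deriv (overlap \<kappa> \<kappa>') (transition \<kappa> \<kappa>') q u)
            (dir_deriv (overlap \<kappa> \<kappa>') (transition \<kappa> \<kappa>') q v))"

definition Ric ::
    "('m, 'e::euclidean_space) metrics \<Rightarrow> ('m, 'e) chart \<Rightarrow> real \<Rightarrow> 'e \<Rightarrow> 'e \<Rightarrow> 'e \<Rightarrow> real" where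
  "Ric g \<kappa> t = ricci (chart_img \<kappa>) (g \<kappa> t)"

definition ricci_flow ::
    "('m, 'e::euclidean_space) chart set \<Rightarrow> real set \<Rightarrow> ('m, 'e) metrics \<Rightarrow> bool" where
  "ricci_flow A I g \<longleftrightarrow>
     smooth_metrics A I g \<and>
     (\<forall>\<kappa>\<in>A. \<forall>t\<in>I. \<forall>q\<in>chart_img \<kappa>. \<forall>u v.
        ((\<lambda>s. g \<kappa> s q u v) has_real_derivative - 2 * Ric g \<kappa> t q u v) (at t within I))"

definition ricci_norm_bound ::
    "('m, 'e::euclidean_space) chart set \<Rightarrow> real set \<Rightarrow> ('m, 'e) metrics \<Rightarrow> real \<Rightarrow> bool" where
  "ricci_norm_bound A I g C \<longleftrightarrow>
     (\<forall>\<kappa>\<in>A. \<forall>t\<in>I. \<forall>q\<in>chart_img \<kappa>. tensor_norm (g \<kappa> t q) (Ric g \<kappa> t q) \<le> C)"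

text \<open>The metric \<open>g(t) + dt\<^sup>2\<close> on the product of the manifold with the time interval, in the
  chart \<open>\<kappa> \<times> id\<close> whose image is \<open>chart_img \<kappa> \<times> I\<close>.\<close>

definition spacetime_metric ::
    "('m, 'e::euclidean_space) metrics \<Rightarrow> ('m, 'e) chart
      \<Rightarrow> 'e \<times> real \<Rightarrow> 'e \<times> real \<Rightarrow> 'e \<times> real \<Rightarrow> real" where
  "spacetime_metric g \<kappa> z v w = g \<kappa> (snd z) (fst z) (fst v) (fst w) + snd v * snd w"


section \<open>Families of closed curves\<close>

text \<open>The circle is \<open>\<real> / 2\<pi>\<int>\<close>: a family of closed curves is \<open>2\<pi>\<close>-periodic in \<open>x\<close>.\<close>

definition smooth_closed_curves ::
    "('m::topological_space, 'e::euclidean_space) chart set \<Rightarrow> real set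
      \<Rightarrow> (real \<Rightarrow> real \<Rightarrow> 'm) \<Rightarrow> bool" where
  "smooth_closed_curves A I c \<longleftrightarrow>
     (\<forall>x. \<forall>t\<in>I. c (x + 2 * pi) t = c x t) \<and>
     continuous_on (UNIV \<times> I) (\<lambda>(x, t). c x t) \<and>
     (\<forall>\<kappa>\<in>A. smooth_on {(x, t). t \<in> I \<and> c x t \<in> chart_dom \<kappa>} (\<lambda>(x, t). coord \<kappa> (c x t)))"

text \<open>The suffix \<open>_in\<close> marks the representation in a chart \<open>\<kappa>\<close>, meaningful where
  \<open>c x t \<in> chart_dom \<kappa>\<close>. The letters follow the usual notation: \<open>X\<close> tangent vector, \<open>S = X/|X|\<close>,
  \<open>H = \<nabla>\<^sub>S S\<close>.\<close>

definition curve_in :: "('m, 'e) chart \<Rightarrow> (real \<Rightarrow> real \<Rightarrow> 'm) \<Rightarrow> real \<Rightarrow> real \<Rightarrow> 'e" where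
  "curve_in \<kappa> c x t = coord \<kappa> (c x t)"

definition X_in ::
    "('m, 'e::euclidean_space) chart \<Rightarrow> (real \<Rightarrow> real \<Rightarrow> 'm) \<Rightarrow> real \<Rightarrow> real \<Rightarrow> 'e" where
  "X_in \<kappa> c x t = vector_derivative (\<lambda>y. curve_in \<kappa> c y t) (at x)"

definition immersed_curves ::
    "('m, 'e::euclidean_space) chart set \<Rightarrow> real set \<Rightarrow> (real \<Rightarrow> real \<Rightarrow> 'm) \<Rightarrow> bool" where
  "immersed_curves A I c \<longleftrightarrow>
     (\<forall>\<kappa>\<in>A. \<forall>x. \<forall>t\<in>I. c x t \<in> chart_dom \<kappa> \<longrightarrow> X_in \<kappa> c x t \<noteq> 0)"

definition norm_in ::
    "('m, 'e::euclidean_space) metrics \<Rightarrow> ('m, 'e) chart \<Rightarrow> (real \<Rightarrow> real \<Rightarrow> 'm)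
      \<Rightarrow> real \<Rightarrow> real \<Rightarrow> 'e \<Rightarrow> real" where
  "norm_in g \<kappa> c x t v = sqrt (g \<kappa> t (curve_in \<kappa> c x t) v v)"

definition S_in ::
    "('m, 'e::euclidean_space) metrics \<Rightarrow> ('m, 'e) chart \<Rightarrow> (real \<Rightarrow> real \<Rightarrow> 'm)
      \<Rightarrow> real \<Rightarrow> real \<Rightarrow> 'e" where
  "S_in g \<kappa> c x t = X_in \<kappa> c x t /\<^sub>R norm_in g \<kappa> c x t (X_in \<kappa> c x t)"

definition H_in ::
    "('m, 'e::euclidean_space) metrics \<Rightarrow> ('m, 'e) chart \<Rightarrow> (real \<Rightarrow> real \<Rightarrow> 'm)
      \<Rightarrow> real \<Rightarrow> real \<Rightarrow> 'e" where
  "H_in g \<kappa> c x t =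
     cov_deriv_along (chart_img \<kappa>) (g \<kappa> t) (\<lambda>y. curve_in \<kappa> c y t) (\<lambda>y. S_in g \<kappa> c y t) x
       /\<^sub>R norm_in g \<kappa> c x t (X_in \<kappa> c x t)"

definition curve_shrinking ::
    "('m, 'e::euclidean_space) chart set \<Rightarrow> real set \<Rightarrow> ('m, 'e) metrics
      \<Rightarrow> (real \<Rightarrow> real \<Rightarrow> 'm) \<Rightarrow> bool" where
  "curve_shrinking A I g c \<longleftrightarrow>
     (\<forall>\<kappa>\<in>A. \<forall>x. \<forall>t\<in>I. c x t \<in> chart_dom \<kappa> \<longrightarrow>
        vector_derivative (\<lambda>s. curve_in \<kappa> c x s) (at t within I) = H_in g \<kappa> c x t)"

definition curve_shrinking_flow ::
    "('m::topological_space, 'e::euclidean_space) chart set \<Rightarrow> real set \<Rightarrow> ('m, 'e) metrics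
      \<Rightarrow> (real \<Rightarrow> real \<Rightarrow> 'm) \<Rightarrow> bool" where
  "curve_shrinking_flow A I g c \<longleftrightarrow>
     smooth_closed_curves A I c \<and> immersed_curves A I c \<and> curve_shrinking A I g c"

text \<open>\<open>\<nabla>\<^sub>S H\<close> along \<open>(x, t) \<mapsto> (c x t, t)\<close> for the Levi-Civita connection of
  \<open>spacetime_metric\<close>. Although \<open>H\<close> and \<open>S\<close> are tangent to the manifold factor, this vector has
  in general a nonzero time component.\<close>

definition nabla_S_H_in ::
    "('m, 'e::euclidean_space) metrics \<Rightarrow> ('m, 'e) chart \<Rightarrow> real set \<Rightarrow> (real \<Rightarrow> real \<Rightarrow> 'm)
      \<Rightarrow> real \<Rightarrow> real \<Rightarrow> 'e \<times> real" where
  "nabla_S_H_in g \<kappa> I c x t =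
     cov_deriv_along (chart_img \<kappa> \<times> I) (spacetime_metric g \<kappa>)
       (\<lambda>y. (curve_in \<kappa> c y t, t)) (\<lambda>y. (H_in g \<kappa> c y t, 0)) x
       /\<^sub>R norm_in g \<kappa> c x t (X_in \<kappa> c x t)"

definition nabla_S_H_perp_in ::
    "('m, 'e::euclidean_space) metrics \<Rightarrow> ('m, 'e) chart \<Rightarrow> real set \<Rightarrow> (real \<Rightarrow> real \<Rightarrow> 'm)
      \<Rightarrow> real \<Rightarrow> real \<Rightarrow> 'e \<times> real" where
  "nabla_S_H_perp_in g \<kappa> I c x t =
     (let W = nabla_S_H_in g \<kappa> I c x t; S = (S_in g \<kappa> c x t, 0)
      in W - spacetime_metric g \<kappa> (curve_in \<kappa> c x t, t) W S *\<^sub>R S)"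

text \<open>The scalar quantities below do not depend on the chart in which they are computed.\<close>

definition speed ::
    "('m, 'e::euclidean_space) chart set \<Rightarrow> ('m, 'e) metrics \<Rightarrow> (real \<Rightarrow> real \<Rightarrow> 'm)
      \<Rightarrow> real \<Rightarrow> real \<Rightarrow> real" where
  "speed A g c x t = (let \<kappa> = chart_at A (c x t) in norm_in g \<kappa> c x t (X_in \<kappa> c x t))"

definition curv ::
    "('m, 'e::euclidean_space) chart set \<Rightarrow> ('m, 'e) metrics \<Rightarrow> (real \<Rightarrow> real \<Rightarrow> 'm)
      \<Rightarrow> real \<Rightarrow> real \<Rightarrow> real" where
  "curv A g c x t = (let \<kappa> = chart_at A (c x t) in norm_in g \<kappa> c x t (H_in g \<kappa> c x t))"

definition nabla_S_H_perp_sq ::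
    "('m, 'e::euclidean_space) chart set \<Rightarrow> real set \<Rightarrow> ('m, 'e) metrics
      \<Rightarrow> (real \<Rightarrow> real \<Rightarrow> 'm) \<Rightarrow> real \<Rightarrow> real \<Rightarrow> real" where
  "nabla_S_H_perp_sq A I g c x t =
     (let \<kappa> = chart_at A (c x t); N = nabla_S_H_perp_in g \<kappa> I c x t
      in spacetime_metric g \<kappa> (curve_in \<kappa> c x t, t) N N)"

definition arc_deriv ::
    "('m, 'e::euclidean_space) chart set \<Rightarrow> ('m, 'e) metrics \<Rightarrow> (real \<Rightarrow> real \<Rightarrow> 'm)
      \<Rightarrow> (real \<Rightarrow> real \<Rightarrow> real) \<Rightarrow> real \<Rightarrow> real \<Rightarrow> real" where
  "arc_deriv A g c f x t = vector_derivative (\<lambda>y. f y t) (at x) / speed A g c x t"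

definition curvature_evolution_constant ::
    "('m::topological_space, 'e::euclidean_space) chart set \<Rightarrow> real set \<Rightarrow> ('m, 'e) metrics
      \<Rightarrow> real \<Rightarrow> bool" where
  "curvature_evolution_constant A I g C \<longleftrightarrow>
     (\<forall>c. curve_shrinking_flow A I g c \<longrightarrow>
       (\<forall>x. \<forall>t\<in>I.
          vector_derivative (\<lambda>s. (curv A g c x s)\<^sup>2) (at t within I)
            \<le> arc_deriv A g c (arc_deriv A g c (\<lambda>y s. (curv A g c y s)\<^sup>2)) x t
               - 2 * nabla_S_H_perp_sq A I g c x t
               + 2 * curv A g c x t ^ 4
               + C * ((curv A g c x t)\<^sup>2 + curv A g c x t)))"

definition curve_length ::
    "('m, 'e::euclidean_space) chart set \<Rightarrow> ('m, 'e) metrics \<Rightarrow> (real \<Rightarrow> real \<Rightarrow> 'm)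
      \<Rightarrow> real \<Rightarrow> real" where
  "curve_length A g c t = integral {0..2 * pi} (\<lambda>x. speed A g c x t)"

definition total_curvature ::
    "('m, 'e::euclidean_space) chart set \<Rightarrow> ('m, 'e) metrics \<Rightarrow> (real \<Rightarrow> real \<Rightarrow> 'm)
      \<Rightarrow> real \<Rightarrow> real" where
  "total_curvature A g c t = integral {0..2 * pi} (\<lambda>x. curv A g c x t * speed A g c x t)"

end

theory Submission
  imports Defs
begin

text \<open>
  By the flow equation the curvature vector \<open>H\<close> is the velocity of the curve, so \<open>|X|\<^sup>2\<close> and \<open>k\<^sup>2\<close>
  are smooth on the strip \<open>\<real> \<times> [0,T]\<close>. Differentiating \<open>g(S, S) = 1\<close> and \<open>g(H, S) = 0\<close> along the
  curve gives \<open>\<partial>\<^sub>t|X| = - (k\<^sup>2 + Ric(S, S)) |X| \<le> (C\<^sub>2 - k\<^sup>2) |X|\<close>, and the length bound follows by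
  Gronwall's inequality. As \<open>k\<close> need not be differentiable at its zeros, the total curvature is
  replaced by the integral of \<open>K = sqrt (k\<^sup>2 + \<epsilon>\<^sup>2)\<close>. Since \<open>(k\<^sup>2)' = 2 \<langle>(\<nabla>\<^sub>S H)\<^sup>\<bottom>, H\<rangle>\<close>, the
  Cauchy--Schwarz inequality shows that the gradient term of \<open>\<partial>\<^sub>t K\<close> is dominated by the term
  \<open>- 2 |(\<nabla>\<^sub>S H)\<^sup>\<bottom>|\<^sup>2\<close>; \<open>K''\<close> integrates to zero over the closed curve, and
  \<open>\<partial>\<^sub>t ((K + 1) |X|) \<le> K'' |X| + (C\<^sub>1 + C\<^sub>2) (K + 1) |X|\<close>. Finally \<open>\<epsilon>\<close> tends to zero.\<close>

text \<open>Time runs over a closed interval, so at its ends time derivatives are one-sided.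
  Uniqueness of derivatives, symmetry of mixed partials and gluing of local smoothness are therefore
  set up for relatively open parts of the strip. The definitions of speed and curvature choose a
  chart separately at every point, so their dependence on (x,t) becomes regular only through chart
  independence.

  The constants come from \<partial>_t K = \<partial>_t (k^2) / (2 K): the factor 2 turns Chat into
  C1 = Chat/2, and division by K turns k^2 + k into at most K + 1. Such a term is not controlled by
  a multiple of K alone where the curvature is small; adding the length to the total curvature
  closes the inequality. The quartic term contributes at most k^2 K |X|, which is what the loss of
  length - k^2 |X| takes away again.\<close>

section \<open>Calculus of smooth maps\<close>

text \<open>The condition under which derivatives within \<open>S\<close> are unique.\<close>

definition thick :: "'a::euclidean_space set \<Rightarrow> bool" where
  "thick S \<longleftrightarrow> (\<forall>p\<in>S. \<forall>i\<in>Basis. \<forall>e>0. \<exists>d. 0 < \<bar>d\<bar> \<and> \<bar>d\<bar> < e \<and> p + d *\<^sub>R i \<in> S)"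

lemma thick_unique:
  assumes "thick S" "p \<in> S"
    and "(f has_derivative D) (at p within S)" "(f has_derivative D') (at p within S)"
  shows "D = D'"
  using frechet_derivative_unique_within[OF assms(3,4)] assms(1,2) unfolding thick_def by blast

text \<open>\<open>frechet_derivative\<close> is a choice among derivatives; on a thick set there is
  only one to choose, so any derivative that has been computed is the chosen one.\<close>

lemma dir_deriv_eqI:
  assumes "thick S" "p \<in> S" "(f has_derivative D) (at p within S)"
  shows "dir_deriv S f p u = D u"
proof -
  have "(f has_derivative frechet_derivative f (at p within S)) (at p within S)"
    using assms(3) differentiableI frechet_derivative_works by blast
  then show ?thesis
    unfolding dir_deriv_def using thick_unique[OF assms(1,2)] assms(3) by metis
qed

lemma dir_deriv_works:
  assumes "f differentiable (at p within S)"
  shows "(f has_derivative dir_deriv S f p) (at p within S)"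
  using assms unfolding dir_deriv_def by (simp add: frechet_derivative_works)

lemma thick_Int_open:
  assumes "thick S" "open W"
  shows "thick (S \<inter> W)"
  unfolding thick_def
proof (intro ballI allI impI)
  fix p i :: 'a and e :: real
  assume p: "p \<in> S \<inter> W" and i: "i \<in> Basis" and e: "0 < e"
  from p assms(2) obtain r where r: "r > 0" "ball p r \<subseteq> W"
    by (meson IntD2 open_contains_ball)
  obtain d where d: "0 < \<bar>d\<bar>" "\<bar>d\<bar> < min e r" "p + d *\<^sub>R i \<in> S"
    using assms(1) p i e r(1) unfolding thick_def by (metis IntD1 min_less_iff_conj)
  have "p + d *\<^sub>R i \<in> ball p r"
    using d(2) i by (simp add: dist_norm)
  then show "\<exists>d. 0 < \<bar>d\<bar> \<and> \<bar>d\<bar> < e \<and> p + d *\<^sub>R i \<in> S \<inter> W"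
    using d r by auto
qed

lemma thick_UNIV: "thick (UNIV :: 'a::euclidean_space set)"
  unfolding thick_def
proof (intro ballI allI impI)
  fix p i :: 'a and e :: real
  assume "0 < e"
  then show "\<exists>d. 0 < \<bar>d\<bar> \<and> \<bar>d\<bar> < e \<and> p + d *\<^sub>R i \<in> UNIV"
    by (intro exI[of _ "e / 2"]) auto
qed

lemma thick_open: "open S \<Longrightarrow> thick S"
  using thick_Int_open[OF thick_UNIV] by simp

lemma thick_interval:
  fixes T :: real
  assumes "0 < T"
  shows "thick {0..T}"
  unfolding thick_def
proof (intro ballI allI impI)
  fix p i e :: real
  assume p: "p \<in> {0..T}" and i: "i \<in> Basis" and e: "0 < e"
  show "\<exists>d. 0 < \<bar>d\<bar> \<and> \<bar>d\<bar> < e \<and> p + d *\<^sub>R i \<in> {0..T}"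
  \<comment> \<open>At p = T the admissible steps go to the left, and T > 0 leaves room for
    them.\<close>
  proof (cases "p < T")
    case True
    then show ?thesis using p i e by (intro exI[of _ "min (e/2) (T - p)"]) auto
  next
    case False
    then show ?thesis using p i e assms by (intro exI[of _ "- min (e/2) T"]) auto
  qed
qed

lemma thick_Times:
  assumes "thick S" "thick S'"
  shows "thick (S \<times> S')"
  unfolding thick_def
proof (intro ballI allI impI)
  fix p i :: "'a \<times> 'b" and e :: real
  assume p: "p \<in> S \<times> S'" and i: "i \<in> Basis" and e: "0 < e"
  from i consider b where "b \<in> Basis" "i = (b, 0)" | b where "b \<in> Basis" "i = (0, b)"
    unfolding Basis_prod_def by auto
  then show "\<exists>d. 0 < \<bar>d\<bar> \<and> \<bar>d\<bar> < e \<and> p + d *\<^sub>R i \<in> S \<times> S'"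
  proof cases
    case 1
    then show ?thesis using assms(1) p e unfolding thick_def
      by (cases p) (force simp: mem_Times_iff)
  next
    case 2
    then show ?thesis using assms(2) p e unfolding thick_def
      by (cases p) (force simp: mem_Times_iff)
  qed
qed

section \<open>Closure properties of C^k maps\<close>

lemma Ck_on_cong:
  assumes "Ck_on k S f" "\<And>x. x \<in> S \<Longrightarrow> f x = h x"
  shows "Ck_on k S h"
proof (cases k)
  case 0
  then show ?thesis using assms continuous_on_cong[of S S f h] by simp
next
  case (Suc m)
  then obtain D where "\<forall>x\<in>S. (f has_derivative D x) (at x within S)" "\<forall>v. Ck_on m S (\<lambda>x. D x v)"
    using assms(1) by auto
  then show ?thesis unfolding Suc Ck_on.simps
    by (intro exI[of _ D]) (metis assms(2) has_derivative_transform)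
qed

text \<open>\<open>Ck_on (Suc k)\<close> records the regularity of the derivatives only, while the
  product and chain rules leave the maps themselves undifferentiated beside them.\<close>

lemma Ck_on_SucD: "Ck_on (Suc k) S f \<Longrightarrow> Ck_on k S f"
proof (induction k arbitrary: f)
  case 0
  then show ?case
    by (auto intro: has_derivative_continuous_on)
next
  case (Suc k)
  then obtain D where "\<forall>x\<in>S. (f has_derivative D x) (at x within S)"
      "\<forall>v. Ck_on (Suc k) S (\<lambda>x. D x v)"
    by (subst (asm) Ck_on.simps(2)) blast
  then have "(\<forall>x\<in>S. (f has_derivative D x) (at x within S)) \<and> (\<forall>v. Ck_on k S (\<lambda>x. D x v))"
    using Suc.IH by blast
  then show ?case unfolding Ck_on.simps(2)[of k] by blast
qed

lemma Ck_on_imp_continuous_on: "Ck_on k S f \<Longrightarrow> continuous_on S f"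
  by (induction k) (auto dest: Ck_on_SucD simp del: Ck_on.simps(2))

lemma Ck_on_const: "Ck_on k S (\<lambda>_. c)"
proof (induction k arbitrary: c)
  case (Suc k)
  show ?case
    by (auto intro!: exI[of _ "\<lambda>_ _. 0"] Suc)
qed auto

lemma Ck_on_add: "Ck_on k S f \<Longrightarrow> Ck_on k S h \<Longrightarrow> Ck_on k S (\<lambda>x. f x + h x)"
proof (induction k arbitrary: f h)
  case 0
  then show ?case by (auto intro: continuous_intros)
next
  case (Suc k)
  from Suc.prems obtain D D' where
    "\<forall>x\<in>S. (f has_derivative D x) (at x within S)" "\<forall>v. Ck_on k S (\<lambda>x. D x v)"
    "\<forall>x\<in>S. (h has_derivative D' x) (at x within S)" "\<forall>v. Ck_on k S (\<lambda>x. D' x v)"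
    by auto
  then show ?case
    by (auto intro!: exI[of _ "\<lambda>x v. D x v + D' x v"] has_derivative_add Suc.IH)
qed

lemma Ck_on_sum:
  assumes "\<And>i. i \<in> B \<Longrightarrow> Ck_on k S (f i)"
  shows "Ck_on k S (\<lambda>x. \<Sum>i\<in>B. f i x)"
  using assms
  by (induction B rule: infinite_finite_induct) (auto intro: Ck_on_add Ck_on_const)

lemma Ck_on_bounded_linear:
  assumes "bounded_linear L"
  shows "Ck_on k S f \<Longrightarrow> Ck_on k S (\<lambda>x. L (f x))"
proof (induction k arbitrary: f)
  case 0
  then show ?case using bounded_linear.continuous_on[OF assms] by auto
next
  case (Suc k)
  from Suc.prems obtain D where
    "\<forall>x\<in>S. (f has_derivative D x) (at x within S)" "\<forall>v. Ck_on k S (\<lambda>x. D x v)"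
    by auto
  then show ?case
    by (auto intro!: exI[of _ "\<lambda>x v. L (D x v)"] Suc.IH
        bounded_linear.has_derivative[OF assms])
qed

lemma Ck_on_scaleR:
  fixes f :: "'a::real_normed_vector \<Rightarrow> real"
  shows "Ck_on k S f \<Longrightarrow> Ck_on k S h \<Longrightarrow> Ck_on k S (\<lambda>x. f x *\<^sub>R h x)"
proof (induction k arbitrary: f h)
  case 0
  then show ?case by (auto intro: continuous_intros)
next
  case (Suc k)
  from Suc.prems obtain D D' where D:
    "\<forall>x\<in>S. (f has_derivative D x) (at x within S)" "\<forall>v. Ck_on k S (\<lambda>x. D x v)"
    "\<forall>x\<in>S. (h has_derivative D' x) (at x within S)" "\<forall>v. Ck_on k S (\<lambda>x. D' x v)"
    by auto
  have "Ck_on k S f" "Ck_on k S h"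
    using Suc.prems Ck_on_SucD by blast+
  with D show ?case unfolding Ck_on.simps
    by (intro exI[of _ "\<lambda>x v. f x *\<^sub>R D' x v + D x v *\<^sub>R h x"])
      (auto intro!: has_derivative_scaleR Suc.IH Ck_on_add)
qed

lemma Ck_on_mult:
  fixes f h :: "'a::real_normed_vector \<Rightarrow> real"
  shows "Ck_on k S f \<Longrightarrow> Ck_on k S h \<Longrightarrow> Ck_on k S (\<lambda>x. f x * h x)"
  using Ck_on_scaleR[of k S f h] by simp

text \<open>The chain rule applies \<open>D (h x)\<close> to the varying direction
  \<open>D' x v\<close>, whereas \<open>Ck_on\<close> speaks of fixed directions. Expanding that
  direction in the basis of the intermediate space leaves finitely many fixed ones.\<close>

lemma Ck_on_compose:
  fixes h :: "'a::real_normed_vector \<Rightarrow> 'b::euclidean_space"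
  shows "Ck_on k R f \<Longrightarrow> Ck_on k S h \<Longrightarrow> h ` S \<subseteq> R \<Longrightarrow> Ck_on k S (\<lambda>x. f (h x))"
proof (induction k arbitrary: f)
  case 0
  then show ?case by (auto intro: continuous_on_compose2)
next
  case (Suc k)
  from Suc.prems(1,2)[unfolded Ck_on.simps] obtain D D' where D:
    "\<And>x. x\<in>R \<Longrightarrow> (f has_derivative D x) (at x within R)" "\<And>v. Ck_on k R (\<lambda>x. D x v)"
    "\<And>x. x\<in>S \<Longrightarrow> (h has_derivative D' x) (at x within S)" "\<And>v. Ck_on k S (\<lambda>x. D' x v)"
    by metis
  have h: "Ck_on k S h"
    using Suc.prems(2) Ck_on_SucD by blast
  have "D (h x) (D' x v) = (\<Sum>b\<in>Basis. (D' x v \<bullet> b) *\<^sub>R D (h x) b)" if "x \<in> S" for x v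
  proof -
    have lin: "linear (D (h x))"
      using D(1) that Suc.prems(3) has_derivative_linear by blast
    have "D (h x) (D' x v) = D (h x) (\<Sum>b\<in>Basis. (D' x v \<bullet> b) *\<^sub>R b)"
      by (simp add: euclidean_representation)
    also have "\<dots> = (\<Sum>b\<in>Basis. (D' x v \<bullet> b) *\<^sub>R D (h x) b)"
      using lin by (simp add: linear_sum linear_scale)
    finally show ?thesis .
  qed
  moreover have "Ck_on k S (\<lambda>x. \<Sum>b\<in>Basis. (D' x v \<bullet> b) *\<^sub>R D (h x) b)" for v
    by (intro Ck_on_sum Ck_on_scaleR Suc.IH[OF D(2) h Suc.prems(3)]
        Ck_on_bounded_linear[OF bounded_linear_inner_left] D(4))
  ultimately have "Ck_on k S (\<lambda>x. D (h x) (D' x v))" for v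
    using Ck_on_cong[of k S "\<lambda>x. \<Sum>b\<in>Basis. (D' x v \<bullet> b) *\<^sub>R D (h x) b" "\<lambda>x. D (h x) (D' x v)" for v]
    by simp
  then show ?case
    using has_derivative_in_compose2[OF D(1) Suc.prems(3) _ D(3)]
    unfolding Ck_on.simps by (intro exI[of _ "\<lambda>x v. D (h x) (D' x v)"]) blast
qed

lemma Ck_on_linear:
  assumes "bounded_linear L"
  shows "Ck_on k S L"
proof (cases k)
  case 0
  then show ?thesis using assms by (simp add: linear_continuous_on)
next
  case (Suc k)
  then show ?thesis
    using assms by (auto intro!: exI[of _ "\<lambda>_. L"] bounded_linear_imp_has_derivative Ck_on_const)
qed

lemma Ck_on_Pair:
  assumes "Ck_on k S f" "Ck_on k S h"
  shows "Ck_on k S (\<lambda>x. (f x, h x))"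
  using Ck_on_add[OF Ck_on_bounded_linear[OF bounded_linear_Pair[OF bounded_linear_ident bounded_linear_zero] assms(1)]
      Ck_on_bounded_linear[OF bounded_linear_Pair[OF bounded_linear_zero bounded_linear_ident] assms(2)]]
  by simp

lemma has_derivative_within_Int_open:
  assumes "x \<in> W" "open W"
  shows "(f has_derivative D) (at x within S \<inter> W) \<longleftrightarrow> (f has_derivative D) (at x within S)"
proof -
  have "at x within S \<inter> W = at x within S"
    by (rule at_within_nhd[OF assms]) auto
  then show ?thesis by simp
qed

text \<open>Derivatives found on the pieces \<open>S \<inter> W\<close> are derivatives within S,
  and thickness makes them agree. So \<open>dir_deriv S f\<close> is one global witness for the
  existential in \<open>Ck_on\<close>, and the induction continues with it.\<close>

lemma Ck_on_local:
  fixes S :: "'a::euclidean_space set"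
  assumes "thick S"
  shows "(\<And>x. x \<in> S \<Longrightarrow> \<exists>W. open W \<and> x \<in> W \<and> Ck_on k (S \<inter> W) f) \<Longrightarrow> Ck_on k S f"
proof (induction k arbitrary: f)
  case 0
  show ?case unfolding Ck_on.simps continuous_on_eq_continuous_within
  proof
    fix x assume "x \<in> S"
    then obtain W where W: "open W" "x \<in> W" "continuous_on (S \<inter> W) f"
      using 0 by auto
    have "at x within S \<inter> W = at x within S"
      by (rule at_within_nhd[OF W(2,1)]) auto
    with W \<open>x \<in> S\<close> show "continuous (at x within S) f"
      by (metis IntI continuous_on_eq_continuous_within)
  qed
next
  case (Suc k)
  have loc: "\<exists>W. open W \<and> x \<in> W \<and> (\<forall>y\<in>S\<inter>W. (f has_derivative dir_deriv S f y) (at y within S)) \<and>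
      (\<forall>v. Ck_on k (S \<inter> W) (\<lambda>y. dir_deriv S f y v))" if x: "x \<in> S" for x
  proof -
    obtain W D where W: "open W" "x \<in> W"
      and D: "\<And>y. y\<in>S \<inter> W \<Longrightarrow> (f has_derivative D y) (at y within S \<inter> W)"
        "\<And>v. Ck_on k (S \<inter> W) (\<lambda>y. D y v)"
      using Suc.prems[OF x] by auto
    have D': "(f has_derivative D y) (at y within S)" if "y \<in> S \<inter> W" for y
      using D(1)[OF that] has_derivative_within_Int_open[of y W] W(1) that by blast
    then have eq: "dir_deriv S f y v = D y v" if "y \<in> S \<inter> W" for y v
      using dir_deriv_eqI[OF assms] that by blast
    have "dir_deriv S f y = D y" if "y \<in> S \<inter> W" for y
      using eq[OF that] by blast
    then show ?thesis
      using W D' Ck_on_cong[OF D(2)] eq by (intro exI[of _ W]) auto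
  qed
  have "Ck_on k S (\<lambda>y. dir_deriv S f y v)" for v
    by (rule Suc.IH) (use loc in blast)
  then show ?case
    using loc by (auto intro!: exI[of _ "dir_deriv S f"])
qed

lemma Ck_on_dir_deriv:
  fixes S :: "'a::euclidean_space set"
  assumes "thick S" "Ck_on (Suc k) S f"
  shows "Ck_on k S (\<lambda>x. dir_deriv S f x v)"
    and "\<And>x. x \<in> S \<Longrightarrow> (f has_derivative dir_deriv S f x) (at x within S)"
proof -
  obtain D where D: "\<And>x. x\<in>S \<Longrightarrow> (f has_derivative D x) (at x within S)" "Ck_on k S (\<lambda>x. D x v)"
    using assms(2) by auto
  show "Ck_on k S (\<lambda>x. dir_deriv S f x v)"
    using dir_deriv_eqI[OF assms(1) _ D(1)] by (intro Ck_on_cong[OF D(2)]) auto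
  show "(f has_derivative dir_deriv S f x) (at x within S)" if "x \<in> S" for x
    using D(1)[OF that] dir_deriv_works differentiableI by blast
qed

text \<open>The t-derivative of X is constructed, not assumed: u(y,s) - u(y,t1) is an integral of Y,
  differentiation under the integral sign makes X(x,s) - X(x,t1) an integral of Z, and this can be
  differentiated in s. The argument remains valid at t1 and t2, where the derivative is
  one-sided.\<close>

lemma mixed_derivatives_commute:
  fixes u X Y Z :: "real \<Rightarrow> real \<Rightarrow> 'b::euclidean_space"
  assumes "a < x" "x < b" "t1 < t2" "t1 \<le> t" "t \<le> t2"
    and X: "\<And>y s. y \<in> {a..b} \<Longrightarrow> s \<in> {t1..t2} \<Longrightarrow>
      ((\<lambda>y. u y s) has_vector_derivative X y s) (at y within {a..b})"
    and Y: "\<And>y s. y \<in> {a..b} \<Longrightarrow> s \<in> {t1..t2} \<Longrightarrow>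
      ((\<lambda>s. u y s) has_vector_derivative Y y s) (at s within {t1..t2})"
    and Z: "\<And>y s. y \<in> {a..b} \<Longrightarrow> s \<in> {t1..t2} \<Longrightarrow>
      ((\<lambda>y. Y y s) has_vector_derivative Z y s) (at y within {a..b})"
    and contY: "\<And>y. y \<in> {a..b} \<Longrightarrow> continuous_on {t1..t2} (Y y)"
    and contZ: "continuous_on ({a..b} \<times> {t1..t2}) (\<lambda>(y, s). Z y s)"
  shows "((\<lambda>s. X x s) has_vector_derivative Z x t) (at t within {t1..t2})"
proof -
  have x: "x \<in> {a..b}" using assms by auto
  have int: "integral {t1..s} (Y y) = u y s - u y t1" if "y \<in> {a..b}" "s \<in> {t1..t2}" for y s
  proof (intro integral_unique fundamental_theorem_of_calculus)
    show "(u y has_vector_derivative Y y r) (at r within {t1..s})" if "r \<in> {t1..s}" for r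
      using has_vector_derivative_within_subset[OF Y[of y r], of "{t1..s}"] that
        \<open>y \<in> {a..b}\<close> \<open>s \<in> {t1..t2}\<close> by auto
  qed (use that in auto)
  have X_eq: "X x s = X x t1 + integral {t1..s} (Z x)" if s: "s \<in> {t1..t2}" for s
  proof -
    have "((\<lambda>y. integral (cbox t1 s) (Y y)) has_vector_derivative integral (cbox t1 s) (Z x))
        (at x within {a..b})"
    proof (rule leibniz_rule_vector_derivative)
      show "continuous_on ({a..b} \<times> cbox t1 s) (\<lambda>(y, s). Z y s)"
        by (rule continuous_on_subset[OF contZ]) (use s in auto)
      show "Y y integrable_on cbox t1 s" if "y \<in> {a..b}" for y
        by (rule integrable_continuous) (rule continuous_on_subset[OF contY], use s that in auto)
    qed (use Z s x in auto)
    from has_vector_derivative_transform[OF x _ this, of "\<lambda>y. u y s - u y t1"]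
    have 1: "((\<lambda>y. u y s - u y t1) has_vector_derivative integral {t1..s} (Z x))
        (at x within {a..b})"
      using int[OF _ s] by simp
    have 2: "((\<lambda>y. u y s - u y t1) has_vector_derivative X x s - X x t1) (at x within {a..b})"
      by (intro has_vector_derivative_diff X x s) (use assms in auto)
    have "at x within {a..b} \<noteq> bot"
      using assms by (simp add: trivial_limit_within)
    from vector_derivative_unique_within[OF this 1 2] show ?thesis by simp
  qed
  have "continuous_on {t1..t2} (Z x)"
    using continuous_on_compose2[OF contZ, of "{t1..t2}" "\<lambda>s. (x, s)"] x
    by (auto simp: continuous_on_Pair image_subset_iff)
  then have "((\<lambda>s. X x t1 + integral {t1..s} (Z x)) has_vector_derivative 0 + Z x t)
      (at t within {t1..t2})"
    by (intro has_vector_derivative_add integral_has_vector_derivative) (use assms in auto)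
  from has_vector_derivative_transform[OF _ X_eq this] show ?thesis
    using assms(4,5) by simp
qed

section \<open>Inner product forms\<close>

text \<open>Reduces the regularity of a form with moving arguments to scalar functions: coordinates
  of the arguments and values on fixed basis vectors.\<close>

lemma bilinear_expand:
  fixes B :: "'a::euclidean_space \<Rightarrow> 'b::euclidean_space \<Rightarrow> real"
  assumes "bilinear B"
  shows "B v w = (\<Sum>i\<in>Basis. \<Sum>j\<in>Basis. (v \<bullet> i) * ((w \<bullet> j) * B i j))"
proof -
  have "B v w = B (\<Sum>i\<in>Basis. (v \<bullet> i) *\<^sub>R i) (\<Sum>j\<in>Basis. (w \<bullet> j) *\<^sub>R j)"
    by (simp add: euclidean_representation)
  also have "\<dots> = (\<Sum>(i, j)\<in>Basis \<times> Basis. B ((v \<bullet> i) *\<^sub>R i) ((w \<bullet> j) *\<^sub>R j))"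
    by (rule bilinear_sum[OF assms])
  also have "\<dots> = (\<Sum>i\<in>Basis. \<Sum>j\<in>Basis. (v \<bullet> i) * ((w \<bullet> j) * B i j))"
    by (simp add: sum.cartesian_product bilinear_lmul[OF assms] bilinear_rmul[OF assms]
        mult.left_commute)
  finally show ?thesis .
qed

context
  fixes B :: "'e::euclidean_space \<Rightarrow> 'e \<Rightarrow> real"
  assumes B: "inner_product_form B"
begin

lemma form_bilinear: "bilinear B"
  and form_sym: "B u v = B v u"
  and form_pos: "u \<noteq> 0 \<Longrightarrow> 0 < B u u"
  using B unfolding inner_product_form_def by auto

lemmas form_simps =
  bilinear_ladd[OF form_bilinear] bilinear_radd[OF form_bilinear]
  bilinear_lmul[OF form_bilinear] bilinear_rmul[OF form_bilinear]
  bilinear_lsub[OF form_bilinear] bilinear_rsub[OF form_bilinear]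
  bilinear_lzero[OF form_bilinear] bilinear_rzero[OF form_bilinear]

lemma form_nonneg: "0 \<le> B u u"
  using form_pos[of u] form_simps(7)[of 0] by (cases "u = 0") auto

lemma form_Cauchy_Schwarz: "(B u v)\<^sup>2 \<le> B u u * B v v"
proof (cases "v = 0")
  case True
  then show ?thesis by (simp add: form_simps)
next
  case False
  \<comment> \<open>The vector is \<open>B v v\<close> times the component of u orthogonal to v,
    scaled so that nothing has to be divided.\<close>
  have "0 \<le> B (B v v *\<^sub>R u - B u v *\<^sub>R v) (B v v *\<^sub>R u - B u v *\<^sub>R v)"
    by (rule form_nonneg)
  also have "\<dots> = B v v * (B u u * B v v - (B u v)\<^sup>2)"
    by (simp add: form_simps form_sym[of v u] algebra_simps power2_eq_square)
  finally show ?thesis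
    using form_pos[OF False] by (simp add: zero_le_mult_iff)
qed

text \<open>\<open>L\<close> sends z to the coordinates of the functional \<open>B z\<close>;
  positivity makes it injective, hence onto in finite dimension. Uniqueness matters because
  \<open>christoffel\<close> is a definite description.\<close>

lemma form_Riesz_unique:
  assumes "linear \<phi>"
  shows "\<exists>!z. \<forall>w. B z w = \<phi> w"
proof -
  define L where "L z = (\<Sum>b\<in>Basis. B z b *\<^sub>R b)" for z
  have L_inner: "L z \<bullet> b = B z b" if "b \<in> Basis" for z b
    using that by (simp add: L_def inner_sum_left inner_Basis if_distrib cong: if_cong)
  have "linear L"
    unfolding L_def by (intro linearI) (simp_all add: form_simps sum.distrib scaleR_add_left
        scaleR_sum_right)
  moreover have "z = 0" if "L z = 0" for z
  proof (rule ccontr)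
    assume "z \<noteq> 0"
    have "B z b = 0" if "b \<in> Basis" for b
      using L_inner[OF that, of z] \<open>L z = 0\<close> by simp
    moreover have "linear (B z)"
      using form_bilinear unfolding bilinear_def by blast
    ultimately have "B z z = 0"
      using linear_eq_stdbasis[of "B z" "\<lambda>_. 0"] by (simp add: linear_zero fun_eq_iff)
    then show False using form_pos[OF \<open>z \<noteq> 0\<close>] by simp
  qed
  ultimately have "surj L"
    using linear_injective_imp_surjective linear_injective_0 by blast
  then obtain z where z: "L z = (\<Sum>b\<in>Basis. \<phi> b *\<^sub>R b)"
    by (metis surjD)
  have zb: "B z b = \<phi> b" if "b \<in> Basis" for b
    using that L_inner[OF that, of z] unfolding z
    by (simp add: inner_sum_left inner_Basis if_distrib cong: if_cong)
  have "linear (B z)"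
    using form_bilinear unfolding bilinear_def by blast
  then have z_eq: "B z w = \<phi> w" for w
    using linear_eq_stdbasis[OF _ assms] zb by metis
  moreover from z_eq have "\<forall>w. B z w = \<phi> w" by blast
  moreover have "y = z" if "\<forall>w. B y w = \<phi> w" for y
  proof (rule ccontr)
    assume "y \<noteq> z"
    then have "0 < B (y - z) (y - z)" by (intro form_pos) simp
    also have "\<dots> = 0"
      using that z_eq by (simp add: bilinear_lsub[OF form_bilinear])
    finally show False by simp
  qed
  ultimately show ?thesis by blast
qed

text \<open>One Gram-Schmidt step: fewer vectors than the dimension do not span, so some x keeps a
  nonzero remainder when its projection is removed.\<close>

lemma form_extend_orthonormal:
  assumes "finite I" "\<And>i j. i \<in> I \<Longrightarrow> j \<in> I \<Longrightarrow> B (e i) (e j) = (if i = j then 1 else 0)"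
    and "card I < DIM('e)"
  shows "\<exists>v. B v v = 1 \<and> (\<forall>i\<in>I. B v (e i) = 0)"
proof -
  have "dim (span (e ` I)) \<le> card I"
    using assms(1) by (metis card_image_le dim_le_card' dim_span finite_imageI le_trans)
  then have "span (e ` I) \<noteq> UNIV"
    using assms(3) by (metis dim_UNIV leD)
  then obtain x where x: "x \<notin> span (e ` I)" by blast
  define y where "y = x - (\<Sum>i\<in>I. B x (e i) *\<^sub>R e i)"
  have "y \<noteq> 0"
  proof
    assume "y = 0"
    then have "x = (\<Sum>i\<in>I. B x (e i) *\<^sub>R e i)" by (simp add: y_def)
    also have "\<dots> \<in> span (e ` I)"
      by (intro span_sum span_scale span_base) auto
    finally show False using x by simp
  qed
  have lin: "linear (\<lambda>v. B v (e j))" for j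
    using form_bilinear unfolding bilinear_def by blast
  have y: "B y (e j) = 0" if "j \<in> I" for j
  proof -
    have "B (\<Sum>i\<in>I. B x (e i) *\<^sub>R e i) (e j) = (\<Sum>i\<in>I. B x (e i) * B (e i) (e j))"
      using linear_sum[OF lin, of "\<lambda>i. B x (e i) *\<^sub>R e i" I j] by (simp add: form_simps)
    also have "\<dots> = (\<Sum>i\<in>I. if i = j then B x (e i) else 0)"
      by (rule sum.cong) (use assms(2) that in auto)
    also have "\<dots> = B x (e j)"
      using that assms(1) by simp
    finally show ?thesis
      by (simp add: y_def form_simps)
  qed
  have "B (y /\<^sub>R sqrt (B y y)) (y /\<^sub>R sqrt (B y y)) = 1"
    using form_pos[OF \<open>y \<noteq> 0\<close>] by (simp add: form_simps field_simps)
  moreover have "\<forall>i\<in>I. B (y /\<^sub>R sqrt (B y y)) (e i) = 0"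
    using y by (simp add: form_simps)
  ultimately show ?thesis by blast
qed

text \<open>\<open>tensor_norm\<close> takes its frame by \<open>SOME\<close>; existence gives that
  choice a meaning.\<close>

lemma orthonormal_frame_exists: "\<exists>e. orthonormal_frame B e"
proof -
  have "\<exists>e. \<forall>i\<in>I. \<forall>j\<in>I. B (e i) (e j) = (if i = j then 1 else 0)"
    if "finite I" "I \<subseteq> (Basis :: 'e set)" for I
    using that
  proof (induction I rule: finite_induct)
    case empty
    then show ?case by simp
  next
    case (insert b I)
    then obtain e where e: "\<And>i j. i \<in> I \<Longrightarrow> j \<in> I \<Longrightarrow> B (e i) (e j) = (if i = j then 1 else 0)"
      by auto
    have "card I < DIM('e)"
      using insert by (intro psubset_card_mono) auto
    then obtain v where v: "B v v = 1" "\<And>i. i \<in> I \<Longrightarrow> B v (e i) = 0"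
      using form_extend_orthonormal[OF insert(1)] e by blast
    have "B (e i) v = 0" if "i \<in> I" for i
      using v(2)[OF that] form_sym by metis
    then show ?case
      by (intro exI[of _ "e(b := v)"]) (use v e insert(2) in auto)
  qed
  from this[OF finite_Basis subset_refl] show ?thesis
    unfolding orthonormal_frame_def .
qed

text \<open>The map \<open>L\<close> carrying the standard basis to the frame satisfies
  \<open>B (L x) (e j) = x \<bullet> j\<close>. It is therefore injective, hence onto, and the
  coefficients of any v = L x can be read off.\<close>

lemma orthonormal_frame_expand:
  assumes "orthonormal_frame B e"
  shows "v = (\<Sum>i\<in>Basis. B v (e i) *\<^sub>R e i)"
proof (rule ccontr)
  assume neq: "v \<noteq> (\<Sum>i\<in>Basis. B v (e i) *\<^sub>R e i)"
  define L where "L x = (\<Sum>i\<in>Basis. (x \<bullet> i) *\<^sub>R e i)" for x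
  have lin: "linear L"
    unfolding L_def by (intro linearI)
      (simp_all add: inner_add_left scaleR_add_left sum.distrib scaleR_sum_right)
  have B_L: "B (L x) (e j) = x \<bullet> j" if "j \<in> Basis" for x j
  proof -
    have "linear (\<lambda>v. B v (e j))"
      using form_bilinear unfolding bilinear_def by blast
    then have "B (L x) (e j) = (\<Sum>i\<in>Basis. (x \<bullet> i) * B (e i) (e j))"
      unfolding L_def using linear_sum[of "\<lambda>v. B v (e j)" "\<lambda>i. (x \<bullet> i) *\<^sub>R e i" Basis]
      by (simp add: form_simps)
    also have "\<dots> = (\<Sum>i\<in>Basis. if i = j then x \<bullet> i else 0)"
      by (rule sum.cong) (use assms that in \<open>auto simp: orthonormal_frame_def\<close>)
    also have "\<dots> = x \<bullet> j"
      using that by simp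
    finally show ?thesis .
  qed
  have "x = 0" if "L x = 0" for x
  proof (rule euclidean_eqI)
    fix j :: 'e assume "j \<in> Basis"
    from B_L[OF this, of x] that show "x \<bullet> j = 0 \<bullet> j"
      by (simp add: bilinear_lzero[OF form_bilinear])
  qed
  then have "inj L"
    using linear_injective_0[OF lin] by blast
  then obtain x where x: "v = L x"
    using linear_injective_imp_surjective[OF lin] by (metis surjD)
  have "(\<Sum>i\<in>Basis. B v (e i) *\<^sub>R e i) = L x"
    unfolding x by (subst (2) L_def) (intro sum.cong refl, simp add: B_L)
  then show False using neq x by simp
qed

text \<open>Cauchy-Schwarz for sums over pairs of indices: \<open>R v v\<close> pairs the matrix of
  R with the products of the coefficients of v, and the family of these products has Euclidean norm
  \<open>B v v\<close>.\<close>

lemma abs_le_tensor_norm: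
  assumes "bilinear R"
  shows "\<bar>R v v\<bar> \<le> tensor_norm B R * B v v"
proof -
  define e where "e = (SOME e. orthonormal_frame B e)"
  have e: "orthonormal_frame B e"
    unfolding e_def using orthonormal_frame_exists by (rule someI_ex)
  define a where "a i = B v (e i)" for i
  have v: "v = (\<Sum>i\<in>Basis. a i *\<^sub>R e i)"
    unfolding a_def by (rule orthonormal_frame_expand[OF e])
  have exp: "F v v = (\<Sum>p\<in>Basis \<times> Basis. (a (fst p) * a (snd p)) * F (e (fst p)) (e (snd p)))"
    if "bilinear F" for F :: "'e \<Rightarrow> 'e \<Rightarrow> real"
  proof -
    have "F v v = F (\<Sum>i\<in>Basis. a i *\<^sub>R e i) (\<Sum>i\<in>Basis. a i *\<^sub>R e i)" using v by simp
    also have "\<dots> = (\<Sum>(i, j)\<in>Basis \<times> Basis. F (a i *\<^sub>R e i) (a j *\<^sub>R e j))"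
      by (rule bilinear_sum[OF that])
    finally show ?thesis
      by (simp add: bilinear_lmul[OF that] bilinear_rmul[OF that] case_prod_beta ac_simps)
  qed
  have Bv: "B v v = (\<Sum>i\<in>Basis. (a i)\<^sup>2)"
  proof -
    have "B v v = (\<Sum>i\<in>Basis. \<Sum>j\<in>Basis. (a i * a j) * B (e i) (e j))"
      using exp[OF form_bilinear] by (simp add: sum.cartesian_product case_prod_beta)
    also have "\<dots> = (\<Sum>i\<in>Basis. \<Sum>j\<in>Basis. if j = i then a i * a j else 0)"
      by (intro sum.cong refl) (use e in \<open>auto simp: orthonormal_frame_def\<close>)
    finally show ?thesis by (simp add: power2_eq_square)
  qed
  have "(\<Sum>p\<in>Basis \<times> Basis. (a (fst p) * a (snd p))\<^sup>2) = (B v v)\<^sup>2"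
    by (simp add: Bv power2_eq_square sum_product sum.cartesian_product case_prod_beta algebra_simps)
  moreover have "\<bar>R v v\<bar> \<le> L2_set (\<lambda>p. a (fst p) * a (snd p)) (Basis \<times> Basis) *
      L2_set (\<lambda>p. R (e (fst p)) (e (snd p))) (Basis \<times> Basis)"
    unfolding exp[OF assms]
    by (rule order_trans[OF sum_abs]) (simp only: abs_mult[of "_ * _"] L2_set_mult_ineq)
  ultimately show ?thesis
    using form_nonneg[of v]
    by (simp add: tensor_norm_def Let_def e_def[symmetric] L2_set_def sum.cartesian_product
        case_prod_beta mult.commute)
qed

end

section \<open>Koszul formula\<close>

text \<open>This makes the Koszul expression linear in its last argument, and lets the derivatives
  of the coefficients of a form recombine into one term on the actual arguments.\<close>

lemma bilinear_dir_deriv: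
  assumes "thick Z" "z \<in> Z" "\<And>q. q \<in> Z \<Longrightarrow> bilinear (G q)"
    and diff: "\<And>a b. (\<lambda>q. G q a b :: real) differentiable (at z within Z)"
  shows "bilinear (\<lambda>a b. dir_deriv Z (\<lambda>q. G q a b) z u)"
proof -
  note d = dir_deriv_works[OF diff]
  note eq = dir_deriv_eqI[OF assms(1,2)]
  have tr: "(f has_derivative D) (at z within Z) \<Longrightarrow> (\<And>q. q \<in> Z \<Longrightarrow> h q = f q) \<Longrightarrow>
      (h has_derivative D) (at z within Z)" for f h :: "_ \<Rightarrow> real" and D
    using has_derivative_transform[OF assms(2)] by blast
  show ?thesis
    unfolding bilinear_def
  proof (intro conjI allI linearI)
    show "dir_deriv Z (\<lambda>q. G q x (b + c)) z u =
        dir_deriv Z (\<lambda>q. G q x b) z u + dir_deriv Z (\<lambda>q. G q x c) z u" for x b c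
      by (rule eq, rule tr[OF has_derivative_add[OF d d]]) (use assms(3) bilinear_radd in blast)
    show "dir_deriv Z (\<lambda>q. G q x (r *\<^sub>R b)) z u = r *\<^sub>R dir_deriv Z (\<lambda>q. G q x b) z u" for x b r
      by (rule eq, rule tr[OF has_derivative_scaleR_right[OF d]]) (use assms(3) bilinear_rmul in blast)
    show "dir_deriv Z (\<lambda>q. G q (b + c) x) z u =
        dir_deriv Z (\<lambda>q. G q b x) z u + dir_deriv Z (\<lambda>q. G q c x) z u" for x b c
      by (rule eq, rule tr[OF has_derivative_add[OF d d]]) (use assms(3) bilinear_ladd in blast)
    show "dir_deriv Z (\<lambda>q. G q (r *\<^sub>R b) x) z u = r *\<^sub>R dir_deriv Z (\<lambda>q. G q b x) z u" for x b r
      by (rule eq, rule tr[OF has_derivative_scaleR_right[OF d]]) (use assms(3) bilinear_lmul in blast)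
  qed
qed

text \<open>The Koszul expression is linear in w, so the Riesz lemma supplies exactly one vector
  representing it. Christoffel vectors are never computed below; they are only paired with a
  suitable w through this identity.\<close>

lemma christoffel_Koszul:
  fixes G :: "'e::euclidean_space \<Rightarrow> 'e \<Rightarrow> 'e \<Rightarrow> real"
  assumes "thick Z" "z \<in> Z" "\<And>q. q \<in> Z \<Longrightarrow> inner_product_form (G q)"
    and diff: "\<And>a b. (\<lambda>q. G q a b) differentiable (at z within Z)"
  shows "2 * G z (christoffel Z G z u v) w =
    dir_deriv Z (\<lambda>q. G q v w) z u + dir_deriv Z (\<lambda>q. G q u w) z v - dir_deriv Z (\<lambda>q. G q u v) z w"
proof -
  let ?K = "\<lambda>w. dir_deriv Z (\<lambda>q. G q v w) z u + dir_deriv Z (\<lambda>q. G q u w) z v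
      - dir_deriv Z (\<lambda>q. G q u v) z w"
  have bil: "bilinear (\<lambda>a b. dir_deriv Z (\<lambda>q. G q a b) z u)" for u
    by (rule bilinear_dir_deriv[OF assms(1,2) _ diff]) (use assms(3) form_bilinear in blast)
  have "linear ?K"
  proof (intro linear_compose_add linear_compose_sub)
    show "linear (\<lambda>w. dir_deriv Z (\<lambda>q. G q v w) z u)" "linear (\<lambda>w. dir_deriv Z (\<lambda>q. G q u w) z v)"
      using bil[of u] bil[of v] unfolding bilinear_def by blast+
    show "linear (dir_deriv Z (\<lambda>q. G q u v) z)"
      using dir_deriv_works[OF diff] has_derivative_linear by blast
  qed
  then have "linear (\<lambda>w. ?K w / 2)"
    using linear_compose_scale_right[of ?K "1/2"] by simp
  from form_Riesz_unique[OF assms(3)[OF assms(2)] this]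
  have "\<exists>!y. \<forall>w. 2 * G z y w = ?K w"
    by (simp add: field_simps)
  then show ?thesis
    unfolding christoffel_def by (rule theI'[THEN spec])
qed

text \<open>Expansion in the basis reduces this to the product rule for scalars. The general Z and J
  serve both the x-direction, over a chart image at fixed time, and the one-sided t-direction, over
  the chart image times the time interval.\<close>

lemma form_has_real_derivative:
  fixes z :: "real \<Rightarrow> 'z::euclidean_space" and G :: "'z \<Rightarrow> 'e::euclidean_space \<Rightarrow> 'e \<Rightarrow> real"
  assumes "thick Z" "\<And>q. q \<in> Z \<Longrightarrow> bilinear (G q)" "z ` J \<subseteq> Z" "t \<in> J"
    and diff: "\<And>a b. (\<lambda>q. G q a b) differentiable (at (z t) within Z)"
    and z: "(z has_vector_derivative z') (at t within J)"
    and V: "(V has_vector_derivative V') (at t within J)"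
    and W: "(W has_vector_derivative W') (at t within J)"
  shows "((\<lambda>s. G (z s) (V s) (W s)) has_real_derivative
    dir_deriv Z (\<lambda>q. G q (V t) (W t)) (z t) z' + G (z t) V' (W t) + G (z t) (V t) W') (at t within J)"
proof -
  have zt: "z t \<in> Z" using assms by auto
  let ?D = "\<lambda>i j. dir_deriv Z (\<lambda>q. G q i j) (z t) z'"
  have comp: "((\<lambda>s. G (z s) i j) has_real_derivative ?D i j) (at t within J)" for i j
  proof -
    have d: "((\<lambda>q. G q i j) has_derivative dir_deriv Z (\<lambda>q. G q i j) (z t)) (at (z t) within z ` J)"
      using has_derivative_subset[OF dir_deriv_works[OF diff] assms(3)] .
    have "((\<lambda>s. G (z s) i j) has_derivative (\<lambda>h. dir_deriv Z (\<lambda>q. G q i j) (z t) (h *\<^sub>R z')))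
        (at t within J)"
      using has_derivative_in_compose[OF z[unfolded has_vector_derivative_def] d] .
    moreover have "dir_deriv Z (\<lambda>q. G q i j) (z t) (h *\<^sub>R z') = ?D i j * h" for h
      using has_derivative_linear[OF d] by (simp add: linear_scale)
    ultimately show ?thesis
      unfolding has_field_derivative_def by (simp add: mult.commute[of _ "?D i j"] fun_eq_iff)
  qed
  have VW: "((\<lambda>s. V s \<bullet> i) has_real_derivative V' \<bullet> i) (at t within J)"
    "((\<lambda>s. W s \<bullet> i) has_real_derivative W' \<bullet> i) (at t within J)" for i
    using bounded_linear.has_vector_derivative[OF bounded_linear_inner_left V]
      bounded_linear.has_vector_derivative[OF bounded_linear_inner_left W]
    by (simp_all add: has_real_derivative_iff_has_vector_derivative)
  have "((\<lambda>s. \<Sum>i\<in>Basis. \<Sum>j\<in>Basis. (V s \<bullet> i) * ((W s \<bullet> j) * G (z s) i j)) has_real_derivative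
      (\<Sum>i\<in>Basis. \<Sum>j\<in>Basis. (V' \<bullet> i) * ((W t \<bullet> j) * G (z t) i j) +
        ((W' \<bullet> j) * G (z t) i j + ?D i j * (W t \<bullet> j)) * (V t \<bullet> i))) (at t within J)"
    by (intro DERIV_sum DERIV_mult VW comp)
  moreover have "(\<Sum>i\<in>Basis. \<Sum>j\<in>Basis. (V' \<bullet> i) * ((W t \<bullet> j) * G (z t) i j) +
        ((W' \<bullet> j) * G (z t) i j + ?D i j * (W t \<bullet> j)) * (V t \<bullet> i)) =
    (\<Sum>i\<in>Basis. \<Sum>j\<in>Basis. (V t \<bullet> i) * ((W t \<bullet> j) * ?D i j)) +
    (\<Sum>i\<in>Basis. \<Sum>j\<in>Basis. (V' \<bullet> i) * ((W t \<bullet> j) * G (z t) i j)) +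
    (\<Sum>i\<in>Basis. \<Sum>j\<in>Basis. (V t \<bullet> i) * ((W' \<bullet> j) * G (z t) i j))"
    unfolding sum.distrib[symmetric] by (intro sum.cong refl) (simp add: algebra_simps)
  also have "\<dots> = ?D (V t) (W t) + G (z t) V' (W t) + G (z t) (V t) W'"
    using bilinear_expand[OF bilinear_dir_deriv[OF assms(1) zt assms(2) diff], of "V t" "W t" z']
      bilinear_expand[OF assms(2)[OF zt]] by metis
  finally have "((\<lambda>s. \<Sum>i\<in>Basis. \<Sum>j\<in>Basis. (V s \<bullet> i) * ((W s \<bullet> j) * G (z s) i j)) has_real_derivative
      ?D (V t) (W t) + G (z t) V' (W t) + G (z t) (V t) W') (at t within J)" .
  then show ?thesis
    unfolding has_field_derivative_def
    by (rule has_derivative_transform[rotated 2])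
      (use assms(3,4) bilinear_expand[OF assms(2)] in \<open>auto simp: image_subset_iff\<close>)
qed

section \<open>Partial derivatives on a strip\<close>

text \<open>Horizontal lines stay inside the strip, which gives a full derivative
  \<open>at x\<close>; in the time direction only \<open>at t within I\<close> is available.
  Intersecting with the open set W changes no derivative.\<close>

lemma has_partial_x_strip:
  fixes f :: "real \<times> real \<Rightarrow> 'b::real_normed_vector"
  assumes "open W" "(x, t) \<in> (UNIV \<times> I) \<inter> W"
    and "(f has_derivative D) (at (x, t) within (UNIV \<times> I) \<inter> W)"
  shows "((\<lambda>y. f (y, t)) has_vector_derivative D (1, 0)) (at x)"
proof -
  have D: "(f has_derivative D) (at (x, t) within UNIV \<times> I)"
    using assms has_derivative_within_Int_open[of "(x, t)" W f D "UNIV \<times> I"] by simp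
  have "((\<lambda>y. (y, t)) has_derivative (\<lambda>h. (h, 0))) (at x)"
    by (intro has_derivative_Pair has_derivative_ident has_derivative_const)
  moreover have "(f has_derivative D) (at (x, t) within range (\<lambda>y. (y, t)))"
    by (rule has_derivative_subset[OF D]) (use assms in auto)
  ultimately have "((\<lambda>y. f (y, t)) has_derivative (\<lambda>h. D (h, 0))) (at x)"
    using has_derivative_in_compose[of "\<lambda>y. (y, t)" "\<lambda>h. (h, 0)" x UNIV f D] by simp
  moreover have "(\<lambda>h. D (h, 0)) = (\<lambda>h. h *\<^sub>R D (1, 0))"
  proof
    fix h :: real
    have "(h, 0) = h *\<^sub>R (1::real, 0::real)" by simp
    then show "D (h, 0) = h *\<^sub>R D (1, 0)"
      using linear_scale[OF has_derivative_linear[OF D], of h "(1, 0)"] by metis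
  qed
  ultimately show ?thesis
    unfolding has_vector_derivative_def by simp
qed

lemma has_partial_t_strip:
  fixes f :: "real \<times> real \<Rightarrow> 'b::real_normed_vector"
  assumes "open W" "(x, t) \<in> (UNIV \<times> I) \<inter> W"
    and "(f has_derivative D) (at (x, t) within (UNIV \<times> I) \<inter> W)"
  shows "((\<lambda>s. f (x, s)) has_vector_derivative D (0, 1)) (at t within I)"
proof -
  have D: "(f has_derivative D) (at (x, t) within UNIV \<times> I)"
    using assms has_derivative_within_Int_open[of "(x, t)" W f D "UNIV \<times> I"] by simp
  have "((\<lambda>s. (x, s)) has_derivative (\<lambda>h. (0, h))) (at t within I)"
    by (intro has_derivative_Pair has_derivative_ident has_derivative_const)
  moreover have "(f has_derivative D) (at (x, t) within (\<lambda>s. (x, s)) ` I)"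
    by (rule has_derivative_subset[OF D]) (use assms in auto)
  ultimately have "((\<lambda>s. f (x, s)) has_derivative (\<lambda>h. D (0, h))) (at t within I)"
    by (rule has_derivative_in_compose)
  moreover have "(\<lambda>h. D (0, h)) = (\<lambda>h. h *\<^sub>R D (0, 1))"
  proof
    fix h :: real
    have "(0, h) = h *\<^sub>R (0::real, 1::real)" by simp
    then show "D (0, h) = h *\<^sub>R D (0, 1)"
      using linear_scale[OF has_derivative_linear[OF D], of h "(0, 1)"] by metis
  qed
  ultimately show ?thesis
    unfolding has_vector_derivative_def by simp
qed

lemma thick_strip: "0 < T \<Longrightarrow> open W \<Longrightarrow> thick ((UNIV \<times> {0..T::real}) \<inter> (W :: (real \<times> real) set))"
  by (intro thick_Int_open thick_Times thick_UNIV thick_interval)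

lemma
  fixes f :: "real \<times> real \<Rightarrow> 'b::real_normed_vector"
  assumes "0 < T" "open W" "S = (UNIV \<times> {0..T}) \<inter> W" "Ck_on 1 S f" "(x, t) \<in> S"
  shows strip_partial_x: "((\<lambda>y. f (y, t)) has_vector_derivative dir_deriv S f (x, t) (1, 0)) (at x)"
    and strip_partial_t: "((\<lambda>s. f (x, s)) has_vector_derivative dir_deriv S f (x, t) (0, 1)) (at t within {0..T})"
proof -
  have "(f has_derivative dir_deriv S f (x, t)) (at (x, t) within S)"
    using Ck_on_dir_deriv(2)[of S 0 f] thick_strip[OF assms(1,2)] assms(3-5) by simp
  then show "((\<lambda>y. f (y, t)) has_vector_derivative dir_deriv S f (x, t) (1, 0)) (at x)"
    "((\<lambda>s. f (x, s)) has_vector_derivative dir_deriv S f (x, t) (0, 1)) (at t within {0..T})"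
    using has_partial_x_strip[OF assms(2)] has_partial_t_strip[OF assms(2)] assms(3,5) by blast+
qed

lemma at_within_interval_neq_bot:
  fixes t :: real
  assumes "a < b" "t \<in> {a..b}"
  shows "at t within {a..b} \<noteq> bot"
  using assms by (simp add: trivial_limit_within)

lemma strip_mixed_derivatives:
  fixes f :: "real \<times> real \<Rightarrow> 'b::euclidean_space"
  assumes T: "0 < T" and W: "open W" and S: "S = (UNIV \<times> {0..T}) \<inter> W"
    and f: "Ck_on 2 S f" and xt: "(x, t) \<in> S"
  shows "dir_deriv S (\<lambda>z. dir_deriv S f z (1, 0)) (x, t) (0, 1) =
    dir_deriv S (\<lambda>z. dir_deriv S f z (0, 1)) (x, t) (1, 0)"
proof -
  have f2: "Ck_on (Suc (Suc 0)) S f" using f by (simp only: numeral_2_eq_2)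
  have f1: "Ck_on 1 S f" using Ck_on_SucD[OF f2] by simp
  have thick: "thick S" using thick_strip[OF T W] S by simp
  note fx = Ck_on_dir_deriv(1)[OF thick f2, of "(1, 0)"]
  note ft = Ck_on_dir_deriv(1)[OF thick f2, of "(0, 1)"]
  note ftx = Ck_on_dir_deriv(1)[OF thick ft, of "(1, 0)"]
  obtain A B where AB: "open A" "open B" "x \<in> A" "t \<in> B" "A \<times> B \<subseteq> W"
    using W xt S open_prod_elim[of W "(x, t)"] by (metis IntD2 mem_Sigma_iff)
  obtain d1 where d1: "d1 > 0" "cball x d1 \<subseteq> A" using AB open_contains_cball by metis
  obtain d2 where d2: "d2 > 0" "cball t d2 \<subseteq> B" using AB open_contains_cball by metis
  \<comment> \<open>The closed box around (x,t) is cut off at the ends of the time interval, so t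
    may coincide with t1 or t2.\<close>
  define t1 where "t1 = max 0 (t - d2)"
  define t2 where "t2 = min T (t + d2)"
  have t: "t \<in> {0..T}" using xt S by auto
  have t12: "t1 < t2" "t1 \<le> t" "t \<le> t2" "{t1..t2} \<subseteq> {0..T}"
    using t d2(1) T unfolding t1_def t2_def by auto
  have "{t1..t2} \<subseteq> cball t d2"
    unfolding t1_def t2_def by (auto simp: dist_real_def)
  moreover have "{x - d1..x + d1} \<subseteq> cball x d1"
    by (auto simp: dist_real_def)
  ultimately have R: "{x - d1..x + d1} \<times> {t1..t2} \<subseteq> S"
    using AB d1 d2 t12 S by blast
  have "((\<lambda>s. dir_deriv S f (x, s) (1, 0)) has_vector_derivative
      dir_deriv S (\<lambda>z. dir_deriv S f z (0, 1)) (x, t) (1, 0)) (at t within {t1..t2})"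
  proof (rule mixed_derivatives_commute[of "x - d1" x "x + d1" t1 t2 t "\<lambda>x t. f (x, t)"
        "\<lambda>x s. dir_deriv S f (x, s) (1, 0)" "\<lambda>x s. dir_deriv S f (x, s) (0, 1)"
        "\<lambda>x s. dir_deriv S (\<lambda>z. dir_deriv S f z (0, 1)) (x, s) (1, 0)"])
    fix y s assume ys: "y \<in> {x - d1..x + d1}" "s \<in> {t1..t2}"
    have "(y, s) \<in> S" using R ys by blast
    note p = strip_partial_x[OF T W S f1 this] strip_partial_t[OF T W S f1 this]
      strip_partial_x[OF T W S ft[folded One_nat_def] this]
    show "((\<lambda>y. f (y, s)) has_vector_derivative dir_deriv S f (y, s) (1, 0))
        (at y within {x - d1..x + d1})"
      using p(1) by (rule has_vector_derivative_at_within)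
    show "((\<lambda>s. f (y, s)) has_vector_derivative dir_deriv S f (y, s) (0, 1)) (at s within {t1..t2})"
      using p(2) t12(4) by (rule has_vector_derivative_within_subset)
    show "((\<lambda>y. dir_deriv S f (y, s) (0, 1)) has_vector_derivative
        dir_deriv S (\<lambda>z. dir_deriv S f z (0, 1)) (y, s) (1, 0)) (at y within {x - d1..x + d1})"
      using p(3) by (rule has_vector_derivative_at_within)
  next
    fix y assume "y \<in> {x - d1..x + d1}"
    then have "(\<lambda>s. (y, s)) ` {t1..t2} \<subseteq> S" using R by auto
    then show "continuous_on {t1..t2} (\<lambda>s. dir_deriv S f (y, s) (0, 1))"
      using continuous_on_compose2[OF Ck_on_imp_continuous_on[OF ft], of "{t1..t2}" "\<lambda>s. (y, s)"]
      by (simp add: continuous_on_Pair)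
  next
    show "continuous_on ({x - d1..x + d1} \<times> {t1..t2})
        (\<lambda>(x, s). dir_deriv S (\<lambda>z. dir_deriv S f z (0, 1)) (x, s) (1, 0))"
      using continuous_on_subset[OF Ck_on_imp_continuous_on[OF ftx] R] by (simp add: case_prod_beta)
  qed (use d1 t12 in auto)
  moreover have "((\<lambda>s. dir_deriv S f (x, s) (1, 0)) has_vector_derivative
      dir_deriv S (\<lambda>z. dir_deriv S f z (1, 0)) (x, t) (0, 1)) (at t within {t1..t2})"
    using strip_partial_t[OF T W S fx[folded One_nat_def] xt] t12(4)
    by (rule has_vector_derivative_within_subset)
  ultimately show ?thesis
    using vector_derivative_unique_within[OF at_within_interval_neq_bot[of t1 t2 t]] t12 by auto
qed

section \<open>The flow in a chart\<close>

locale shrinking_flow =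
  fixes A :: "('m::t2_space, 'e::euclidean_space) chart set"
    and T :: real
    and g :: "('m, 'e) metrics"
    and c :: "real \<Rightarrow> real \<Rightarrow> 'm"
  assumes atlas: "smooth_atlas A"
    and T_pos: "0 < T"
    and flow: "ricci_flow A {0..T} g"
    and shrinking: "curve_shrinking_flow A {0..T} g c"
begin

definition chart_region :: "('m, 'e) chart \<Rightarrow> (real \<times> real) set" where
  "chart_region \<kappa> = {(x, t). t \<in> {0..T} \<and> c x t \<in> chart_dom \<kappa>}"

definition pos :: "('m, 'e) chart \<Rightarrow> real \<times> real \<Rightarrow> 'e" where
  "pos \<kappa> = (\<lambda>(x, t). coord \<kappa> (c x t))"

definition tangent :: "('m, 'e) chart \<Rightarrow> real \<times> real \<Rightarrow> 'e" where
  "tangent \<kappa> z = dir_deriv (chart_region \<kappa>) (pos \<kappa>) z (1, 0)"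

definition velocity :: "('m, 'e) chart \<Rightarrow> real \<times> real \<Rightarrow> 'e" where
  "velocity \<kappa> z = dir_deriv (chart_region \<kappa>) (pos \<kappa>) z (0, 1)"

text \<open>Under the flow equation this is \<partial>_x H in coordinates and, by symmetry of mixed
  partials, also \<partial>_t X.\<close>

definition velocity_x :: "('m, 'e) chart \<Rightarrow> real \<times> real \<Rightarrow> 'e" where
  "velocity_x \<kappa> z = dir_deriv (chart_region \<kappa>) (velocity \<kappa>) z (1, 0)"

lemma metrics: "smooth_metrics A {0..T} g"
  using flow unfolding ricci_flow_def by blast

lemma curves: "smooth_closed_curves A {0..T} c" "immersed_curves A {0..T} c"
  "curve_shrinking A {0..T} g c"
  using shrinking unfolding curve_shrinking_flow_def by blast+

context
  fixes \<kappa> :: "('m, 'e) chart"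
  assumes \<kappa>: "\<kappa> \<in> A"
begin

section \<open>The curve in a fixed chart\<close>

lemma chart: "open (chart_dom \<kappa>)" "open (chart_img \<kappa>)"
    "homeomorphism (chart_dom \<kappa>) (chart_img \<kappa>) (coord \<kappa>) (param \<kappa>)"
  using atlas \<kappa> unfolding smooth_atlas_def by blast+

lemma chart_region_open: "\<exists>W. open W \<and> chart_region \<kappa> = (UNIV \<times> {0..T}) \<inter> W"
proof -
  have "continuous_on (UNIV \<times> {0..T}) (\<lambda>(x, t). c x t)"
    using curves(1) unfolding smooth_closed_curves_def by blast
  then obtain W where W: "open W"
    "W \<inter> (UNIV \<times> {0..T}) = (\<lambda>(x, t). c x t) -` chart_dom \<kappa> \<inter> (UNIV \<times> {0..T})"
    using chart(1) unfolding continuous_on_open_invariant by meson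
  moreover have "chart_region \<kappa> = (\<lambda>(x, t). c x t) -` chart_dom \<kappa> \<inter> (UNIV \<times> {0..T})"
    unfolding chart_region_def by auto
  ultimately show ?thesis by (metis Int_commute)
qed

lemma thick_chart_region: "thick (chart_region \<kappa>)"
  using chart_region_open thick_strip[OF T_pos] by auto

lemma pos_smooth: "Ck_on k (chart_region \<kappa>) (pos \<kappa>)"
  using curves(1) \<kappa> unfolding smooth_closed_curves_def smooth_on_def chart_region_def pos_def
  by blast

lemma tangent_smooth: "Ck_on k (chart_region \<kappa>) (tangent \<kappa>)"
  and velocity_smooth: "Ck_on k (chart_region \<kappa>) (velocity \<kappa>)"
  unfolding tangent_def[abs_def] velocity_def[abs_def]
  using Ck_on_dir_deriv(1)[OF thick_chart_region pos_smooth] by blast+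

lemma region_partial_x:
  fixes f :: "real \<times> real \<Rightarrow> 'b::real_normed_vector"
  assumes "Ck_on 1 (chart_region \<kappa>) f" "(x, t) \<in> chart_region \<kappa>"
  shows "((\<lambda>y. f (y, t)) has_vector_derivative dir_deriv (chart_region \<kappa>) f (x, t) (1, 0)) (at x)"
  using strip_partial_x[OF T_pos _ _ assms] chart_region_open by blast

lemma region_partial_t:
  fixes f :: "real \<times> real \<Rightarrow> 'b::real_normed_vector"
  assumes "Ck_on 1 (chart_region \<kappa>) f" "(x, t) \<in> chart_region \<kappa>"
  shows "((\<lambda>s. f (x, s)) has_vector_derivative dir_deriv (chart_region \<kappa>) f (x, t) (0, 1))
    (at t within {0..T})"
  using strip_partial_t[OF T_pos _ _ assms] chart_region_open by blast

lemma tangent_t: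
  assumes "(x, t) \<in> chart_region \<kappa>"
  shows "((\<lambda>s. tangent \<kappa> (x, s)) has_vector_derivative velocity_x \<kappa> (x, t)) (at t within {0..T})"
proof -
  have "velocity_x \<kappa> (x, t) = dir_deriv (chart_region \<kappa>) (tangent \<kappa>) (x, t) (0, 1)"
    unfolding velocity_x_def tangent_def[abs_def] velocity_def[abs_def]
    using strip_mixed_derivatives[OF T_pos _ _ pos_smooth assms] chart_region_open by metis
  then show ?thesis
    using region_partial_t[OF tangent_smooth assms] by simp
qed

lemma curve_in_eq: "curve_in \<kappa> c x t = pos \<kappa> (x, t)"
  by (simp add: curve_in_def pos_def)

lemma X_in_eq: "(x, t) \<in> chart_region \<kappa> \<Longrightarrow> X_in \<kappa> c x t = tangent \<kappa> (x, t)"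
  unfolding X_in_def curve_in_eq tangent_def
  using region_partial_x[OF pos_smooth] by (rule vector_derivative_at)

text \<open>By the flow equation the curvature vector is the velocity; this replaces the
  transformation law of the Christoffel symbols when charts are changed.\<close>

lemma H_in_eq:
  assumes "(x, t) \<in> chart_region \<kappa>"
  shows "H_in g \<kappa> c x t = velocity \<kappa> (x, t)"
proof -
  have t: "t \<in> {0..T}" "c x t \<in> chart_dom \<kappa>"
    using assms unfolding chart_region_def by auto
  have "vector_derivative (\<lambda>s. curve_in \<kappa> c x s) (at t within {0..T}) = velocity \<kappa> (x, t)"
    unfolding curve_in_eq velocity_def
    using region_partial_t[OF pos_smooth assms]
    by (rule vector_derivative_within[OF at_within_interval_neq_bot[OF T_pos t(1)]])
  then show ?thesis
    using curves(3) \<kappa> t unfolding curve_shrinking_def by metis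
qed

lemma tangent_nonzero: "(x, t) \<in> chart_region \<kappa> \<Longrightarrow> tangent \<kappa> (x, t) \<noteq> 0"
  using curves(2) \<kappa> X_in_eq unfolding immersed_curves_def chart_region_def by auto

lemma pos_in: "(x, t) \<in> chart_region \<kappa> \<Longrightarrow> pos \<kappa> (x, t) \<in> chart_img \<kappa>"
  unfolding chart_region_def pos_def chart_img_def by auto

lemma region_time: "(x, t) \<in> chart_region \<kappa> \<Longrightarrow> t \<in> {0..T}"
  unfolding chart_region_def by auto

section \<open>The metric and its derivatives in a fixed chart\<close>

lemma g_form: "t \<in> {0..T} \<Longrightarrow> q \<in> chart_img \<kappa> \<Longrightarrow> inner_product_form (g \<kappa> t q)"
  using metrics \<kappa> unfolding smooth_metrics_def by blast

lemma g_smooth: "Ck_on k (chart_img \<kappa> \<times> {0..T}) (\<lambda>(q, t). g \<kappa> t q a b)"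
  using metrics \<kappa> unfolding smooth_metrics_def smooth_on_def by blast

lemma thick_img: "thick (chart_img \<kappa>)" "thick (chart_img \<kappa> \<times> {0..T})"
  using thick_open chart(2) thick_Times thick_interval[OF T_pos] by blast+

lemma g_has_derivative:
  assumes "q \<in> chart_img \<kappa>" "t \<in> {0..T}"
  shows "((\<lambda>(q, t). g \<kappa> t q a b) has_derivative
      dir_deriv (chart_img \<kappa> \<times> {0..T}) (\<lambda>(q, t). g \<kappa> t q a b) (q, t))
      (at (q, t) within chart_img \<kappa> \<times> {0..T})"
  using Ck_on_dir_deriv(2)[OF thick_img(2) g_smooth] assms by blast

text \<open>Smoothness of the metric is given jointly in (q,t), whereas \<open>christoffel\<close>
  differentiates in space at fixed time; restricting to a time slice links the two.\<close>

lemma g_has_derivative_space: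
  assumes "q \<in> chart_img \<kappa>" "t \<in> {0..T}"
  shows "((\<lambda>q. g \<kappa> t q a b) has_derivative
      (\<lambda>w. dir_deriv (chart_img \<kappa> \<times> {0..T}) (\<lambda>(q, t). g \<kappa> t q a b) (q, t) (w, 0)))
      (at q within chart_img \<kappa>)"
proof -
  have "((\<lambda>q. (q, t)) has_derivative (\<lambda>w. (w, 0))) (at q within chart_img \<kappa>)"
    by (intro has_derivative_Pair has_derivative_ident has_derivative_const)
  moreover have "((\<lambda>(q, t). g \<kappa> t q a b) has_derivative
      dir_deriv (chart_img \<kappa> \<times> {0..T}) (\<lambda>(q, t). g \<kappa> t q a b) (q, t))
      (at (q, t) within (\<lambda>q. (q, t)) ` chart_img \<kappa>)"
    by (rule has_derivative_subset[OF g_has_derivative[OF assms]]) (use assms in auto)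
  ultimately show ?thesis
    using has_derivative_in_compose[of "\<lambda>q. (q, t)"] by fastforce
qed

lemma g_differentiable:
  assumes "q \<in> chart_img \<kappa>" "t \<in> {0..T}"
  shows "(\<lambda>q. g \<kappa> t q a b) differentiable (at q within chart_img \<kappa>)"
  using g_has_derivative_space[OF assms] differentiableI by blast

lemma g_dir_deriv_space:
  assumes "q \<in> chart_img \<kappa>" "t \<in> {0..T}"
  shows "dir_deriv (chart_img \<kappa> \<times> {0..T}) (\<lambda>(q, t). g \<kappa> t q a b) (q, t) (w, 0) =
    dir_deriv (chart_img \<kappa>) (\<lambda>q. g \<kappa> t q a b) q w"
  using dir_deriv_eqI[OF thick_img(1) assms(1) g_has_derivative_space[OF assms]] by simp

lemma g_dir_deriv_time:
  assumes "q \<in> chart_img \<kappa>" "t \<in> {0..T}"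
  shows "dir_deriv (chart_img \<kappa> \<times> {0..T}) (\<lambda>(q, t). g \<kappa> t q a b) (q, t) (0, 1) =
    - 2 * Ric g \<kappa> t q a b"
proof -
  let ?D = "dir_deriv (chart_img \<kappa> \<times> {0..T}) (\<lambda>(q, t). g \<kappa> t q a b) (q, t)"
  have "((\<lambda>s. (q, s)) has_derivative (\<lambda>w. (0, w))) (at t within {0..T})"
    by (intro has_derivative_Pair has_derivative_ident has_derivative_const)
  moreover have "((\<lambda>(q, t). g \<kappa> t q a b) has_derivative ?D)
      (at (q, t) within (\<lambda>s. (q, s)) ` {0..T})"
    by (rule has_derivative_subset[OF g_has_derivative[OF assms]]) (use assms in auto)
  ultimately have 1: "((\<lambda>s. g \<kappa> s q a b) has_derivative (\<lambda>r. ?D (0, r))) (at t within {0..T})"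
    using has_derivative_in_compose[of "\<lambda>s. (q, s)"] by fastforce
  have 2: "((\<lambda>s. g \<kappa> s q a b) has_derivative (*) (- 2 * Ric g \<kappa> t q a b)) (at t within {0..T})"
    using flow \<kappa> assms unfolding ricci_flow_def has_field_derivative_def by blast
  show ?thesis
    using fun_cong[OF thick_unique[OF thick_interval[OF T_pos] assms(2) 1 2], of 1] by simp
qed

text \<open>The direction (w,1) belongs to a point that moves with velocity w while time runs; the
  Ricci term is the explicit time dependence of the metric.\<close>

lemma g_dir_deriv:
  assumes "q \<in> chart_img \<kappa>" "t \<in> {0..T}"
  shows "dir_deriv (chart_img \<kappa> \<times> {0..T}) (\<lambda>(q, t). g \<kappa> t q a b) (q, t) (w, 1) =
    dir_deriv (chart_img \<kappa>) (\<lambda>q. g \<kappa> t q a b) q w - 2 * Ric g \<kappa> t q a b"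
  using linear_add[OF has_derivative_linear[OF g_has_derivative[OF assms, of a b]], of "(w, 0)" "(0, 1)"]
  by (simp add: g_dir_deriv_space[OF assms] g_dir_deriv_time[OF assms])

text \<open>Read off from the flow equation: - 2 Ric is a time derivative of bilinear forms, so the
  curvature tensor need not be expanded.\<close>

lemma Ric_bilinear:
  assumes "q \<in> chart_img \<kappa>" "t \<in> {0..T}"
  shows "bilinear (Ric g \<kappa> t q)"
proof -
  have "bilinear (\<lambda>a b. dir_deriv (chart_img \<kappa> \<times> {0..T})
      (\<lambda>z. (\<lambda>z a b. case z of (q, t) \<Rightarrow> g \<kappa> t q a b) z a b) (q, t) (0, 1))"
  proof (rule bilinear_dir_deriv[OF thick_img(2)])
    show "bilinear (\<lambda>a b. case z of (q, t) \<Rightarrow> g \<kappa> t q a b)"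
      if "z \<in> chart_img \<kappa> \<times> {0..T}" for z
      using that form_bilinear[OF g_form] by (auto simp: case_prod_beta)
  qed (use assms differentiableI[OF g_has_derivative[OF assms]] in auto)
  then have *: "bilinear (\<lambda>a b. - 2 * Ric g \<kappa> t q a b)"
    using g_dir_deriv_time[OF assms] by simp
  have half: "linear R" if "linear (\<lambda>b. - 2 * R b)" for R :: "'e \<Rightarrow> real"
    using linear_compose_scale_right[OF that, of "- 1 / 2"] by simp
  show ?thesis
    using * unfolding bilinear_def by (auto intro: half)
qed

end

definition sq_speed :: "('m, 'e) chart \<Rightarrow> real \<times> real \<Rightarrow> real" where
  "sq_speed \<kappa> z = g \<kappa> (snd z) (pos \<kappa> z) (tangent \<kappa> z) (tangent \<kappa> z)"

text \<open>This is |H|^2 with H replaced by the velocity of the curve, which makes its smoothness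
  visible.\<close>

definition sq_curv :: "('m, 'e) chart \<Rightarrow> real \<times> real \<Rightarrow> real" where
  "sq_curv \<kappa> z = g \<kappa> (snd z) (pos \<kappa> z) (velocity \<kappa> z) (velocity \<kappa> z)"

definition unit_tangent :: "('m, 'e) chart \<Rightarrow> real \<times> real \<Rightarrow> 'e" where
  "unit_tangent \<kappa> z = tangent \<kappa> z /\<^sub>R sqrt (sq_speed \<kappa> z)"

context
  fixes \<kappa> :: "('m, 'e) chart"
  assumes \<kappa>: "\<kappa> \<in> A"
begin

section \<open>Length, curvature and unit tangent on a chart region\<close>

lemma form_smooth:
  assumes "Ck_on k (chart_region \<kappa>) V" "Ck_on k (chart_region \<kappa>) W"
  shows "Ck_on k (chart_region \<kappa>) (\<lambda>z. g \<kappa> (snd z) (pos \<kappa> z) (V z) (W z))"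
proof -
  have in_img: "(\<lambda>z. (pos \<kappa> z, snd z)) ` chart_region \<kappa> \<subseteq> chart_img \<kappa> \<times> {0..T}"
    using pos_in[OF \<kappa>] region_time[OF \<kappa>] by fastforce
  have "Ck_on k (chart_region \<kappa>) (\<lambda>z. (pos \<kappa> z, snd z))"
    by (intro Ck_on_Pair pos_smooth[OF \<kappa>] Ck_on_linear bounded_linear_snd)
  then have g_ij: "Ck_on k (chart_region \<kappa>) (\<lambda>z. g \<kappa> (snd z) (pos \<kappa> z) i j)" for i j
    using Ck_on_compose[OF g_smooth[OF \<kappa>] _ in_img, of k i j] by simp
  have "Ck_on k (chart_region \<kappa>) (\<lambda>z. \<Sum>i\<in>Basis. \<Sum>j\<in>Basis.
      (V z \<bullet> i) * ((W z \<bullet> j) * g \<kappa> (snd z) (pos \<kappa> z) i j))"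
    by (intro Ck_on_sum Ck_on_mult g_ij Ck_on_bounded_linear[OF bounded_linear_inner_left] assms)
  then show ?thesis
  proof (rule Ck_on_cong)
    fix z assume "z \<in> chart_region \<kappa>"
    then have "bilinear (g \<kappa> (snd z) (pos \<kappa> z))"
      using pos_in[OF \<kappa>] region_time[OF \<kappa>] g_form[OF \<kappa>] form_bilinear by (metis prod.collapse)
    then show "(\<Sum>i\<in>Basis. \<Sum>j\<in>Basis. (V z \<bullet> i) * ((W z \<bullet> j) * g \<kappa> (snd z) (pos \<kappa> z) i j)) =
        g \<kappa> (snd z) (pos \<kappa> z) (V z) (W z)"
      by (rule bilinear_expand[symmetric])
  qed
qed

lemma sq_speed_smooth: "Ck_on k (chart_region \<kappa>) (sq_speed \<kappa>)"
  and sq_curv_smooth: "Ck_on k (chart_region \<kappa>) (sq_curv \<kappa>)"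
  unfolding sq_speed_def[abs_def] sq_curv_def[abs_def]
  by (intro form_smooth tangent_smooth[OF \<kappa>] velocity_smooth[OF \<kappa>])+

text \<open>Identities that hold only where the chart sees the curve may be differentiated in x,
  because they hold on a neighbourhood of x.\<close>

lemma row_open: "open {y. (y, t) \<in> chart_region \<kappa>}"
proof (cases "t \<in> {0..T}")
  case True
  obtain W where W: "open W" "chart_region \<kappa> = (UNIV \<times> {0..T}) \<inter> W"
    using chart_region_open[OF \<kappa>] by blast
  have "open ((\<lambda>y. (y, t)) -` W)"
    by (intro open_vimage W continuous_intros)
  moreover have "{y. (y, t) \<in> chart_region \<kappa>} = (\<lambda>y. (y, t)) -` W"
    using True W(2) by auto
  ultimately show ?thesis by simp
next
  case False
  then have "{y. (y, t) \<in> chart_region \<kappa>} = {}"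
    using region_time[OF \<kappa>] by blast
  then show ?thesis by simp
qed

text \<open>Near t the column fills the time interval, so derivatives within the column, where the
  coordinate expressions are meaningful, are the time derivatives on \<open>{0..T}\<close>.\<close>

lemma column_filter:
  assumes "(x, t) \<in> chart_region \<kappa>"
  shows "at t within {s. (x, s) \<in> chart_region \<kappa>} = at t within {0..T}"
proof -
  obtain W where W: "open W" "chart_region \<kappa> = (UNIV \<times> {0..T}) \<inter> W"
    using chart_region_open[OF \<kappa>] by blast
  show ?thesis
  proof (rule at_within_nhd)
    show "open ((\<lambda>s. (x, s)) -` W)"
      by (intro open_vimage W continuous_intros)
  qed (use assms in \<open>auto simp: W(2)\<close>)
qed

context
  fixes x t :: real
  assumes xt: "(x, t) \<in> chart_region \<kappa>"
begin

lemma xt_facts: "t \<in> {0..T}" "pos \<kappa> (x, t) \<in> chart_img \<kappa>"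
    "inner_product_form (g \<kappa> t (pos \<kappa> (x, t)))"
  using region_time[OF \<kappa> xt] pos_in[OF \<kappa> xt] g_form[OF \<kappa>] by auto

lemma form_derivative_x:
  assumes "(V has_vector_derivative V') (at x)" "(W has_vector_derivative W') (at x)"
  shows "((\<lambda>y. g \<kappa> t (pos \<kappa> (y, t)) (V y) (W y)) has_real_derivative
    dir_deriv (chart_img \<kappa>) (\<lambda>q. g \<kappa> t q (V x) (W x)) (pos \<kappa> (x, t)) (tangent \<kappa> (x, t))
    + g \<kappa> t (pos \<kappa> (x, t)) V' (W x) + g \<kappa> t (pos \<kappa> (x, t)) (V x) W') (at x)"
proof -
  let ?J = "{y. (y, t) \<in> chart_region \<kappa>}"
  have J: "at x within ?J = at x"
    using at_within_open[OF _ row_open] xt by simp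
  have "((\<lambda>y. pos \<kappa> (y, t)) has_vector_derivative tangent \<kappa> (x, t)) (at x)"
    unfolding tangent_def using region_partial_x[OF \<kappa> pos_smooth[OF \<kappa>] xt] .
  with form_has_real_derivative[of "chart_img \<kappa>" "g \<kappa> t" "\<lambda>y. pos \<kappa> (y, t)" ?J x, unfolded J]
  show ?thesis
    using thick_img(1)[OF \<kappa>] form_bilinear[OF g_form[OF \<kappa>]] xt_facts pos_in[OF \<kappa>] xt
      g_differentiable[OF \<kappa>] assms by blast
qed

lemma sq_speed_pos: "0 < sq_speed \<kappa> (x, t)"
  unfolding sq_speed_def using form_pos[OF xt_facts(3)] tangent_nonzero[OF \<kappa> xt] by simp

lemma sq_curv_nonneg: "0 \<le> sq_curv \<kappa> (x, t)"
  unfolding sq_curv_def using form_nonneg[OF xt_facts(3)] by simp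

lemma norm_X_in: "norm_in g \<kappa> c x t (X_in \<kappa> c x t) = sqrt (sq_speed \<kappa> (x, t))"
  unfolding norm_in_def sq_speed_def curve_in_eq[OF \<kappa>] X_in_eq[OF \<kappa> xt] by simp

lemma norm_H_in: "norm_in g \<kappa> c x t (H_in g \<kappa> c x t) = sqrt (sq_curv \<kappa> (x, t))"
  unfolding norm_in_def sq_curv_def curve_in_eq[OF \<kappa>] H_in_eq[OF \<kappa> xt] by simp

lemma S_in_eq: "S_in g \<kappa> c x t = unit_tangent \<kappa> (x, t)"
  unfolding S_in_def unit_tangent_def norm_X_in by (simp only: X_in_eq[OF \<kappa> xt])

lemma tangent_eq: "tangent \<kappa> (x, t) = sqrt (sq_speed \<kappa> (x, t)) *\<^sub>R unit_tangent \<kappa> (x, t)"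
  unfolding unit_tangent_def using sq_speed_pos by simp

lemma unit_tangent_norm:
  "g \<kappa> t (pos \<kappa> (x, t)) (unit_tangent \<kappa> (x, t)) (unit_tangent \<kappa> (x, t)) = 1"
  unfolding unit_tangent_def using sq_speed_pos
  by (simp add: form_simps[OF xt_facts(3)] sq_speed_def field_simps)

text \<open>Only existence is recorded: S' is always eliminated through g(S,S) = 1 or g(H,S) = 0
  together with Koszul's formula.\<close>

lemma unit_tangent_differentiable:
  "\<exists>S'. ((\<lambda>y. unit_tangent \<kappa> (y, t)) has_vector_derivative S') (at x)"
proof -
  have "((\<lambda>y. sq_speed \<kappa> (y, t)) has_vector_derivative
      dir_deriv (chart_region \<kappa>) (sq_speed \<kappa>) (x, t) (1, 0)) (at x)"
    using region_partial_x[OF \<kappa> sq_speed_smooth xt] .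
  then obtain p where p: "((\<lambda>y. sq_speed \<kappa> (y, t)) has_real_derivative p) (at x)"
    unfolding has_real_derivative_iff_has_vector_derivative[symmetric] by blast
  have "((\<lambda>y. inverse (sqrt (sq_speed \<kappa> (y, t)))) has_real_derivative
      - (p / (2 * sqrt (sq_speed \<kappa> (x, t)))) / sq_speed \<kappa> (x, t)) (at x)"
    using sq_speed_pos
    by (auto intro!: derivative_eq_intros p simp: field_simps power2_eq_square)
  then show ?thesis
    unfolding unit_tangent_def
    using has_vector_derivative_scaleR region_partial_x[OF \<kappa> tangent_smooth[OF \<kappa>] xt] by blast
qed

end

text \<open>The coordinate form of |X| H = \<nabla>_X S, in which H has become the velocity.\<close>

lemma velocity_christoffel:
  assumes xt: "(x, t) \<in> chart_region \<kappa>"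
    and S': "((\<lambda>y. unit_tangent \<kappa> (y, t)) has_vector_derivative S') (at x)"
  shows "sqrt (sq_speed \<kappa> (x, t)) *\<^sub>R velocity \<kappa> (x, t) = S' +
    christoffel (chart_img \<kappa>) (g \<kappa> t) (pos \<kappa> (x, t)) (tangent \<kappa> (x, t)) (unit_tangent \<kappa> (x, t))"
  (is "_ = S' + ?\<Gamma>")
proof -
  have "((\<lambda>y. S_in g \<kappa> c y t) has_vector_derivative S') (at x)"
    by (rule has_vector_derivative_transform_within_open[OF S' row_open]) (use xt S_in_eq in auto)
  moreover have "vector_derivative (\<lambda>y. pos \<kappa> (y, t)) (at x) = tangent \<kappa> (x, t)"
    using X_in_eq[OF \<kappa> xt] unfolding X_in_def curve_in_eq[OF \<kappa>] .
  ultimately have "H_in g \<kappa> c x t = (S' + ?\<Gamma>) /\<^sub>R sqrt (sq_speed \<kappa> (x, t))"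
    unfolding H_in_def cov_deriv_along_def norm_X_in[OF xt] S_in_eq[OF xt]
    by (simp add: vector_derivative_at curve_in_eq[OF \<kappa>])
  then show ?thesis
    using H_in_eq[OF \<kappa> xt] sq_speed_pos[OF xt] by simp
qed

text \<open>For w = S two terms of Koszul's formula cancel and 2 g(\<Gamma>,S) is the derivative of
  g along X, evaluated on (S,S). Differentiating g(S,S) = 1 shows that this is - 2 g(S',S), so S' +
  \<Gamma> is orthogonal to S.\<close>

lemma velocity_normal:
  assumes xt: "(x, t) \<in> chart_region \<kappa>"
  shows "g \<kappa> t (pos \<kappa> (x, t)) (velocity \<kappa> (x, t)) (unit_tangent \<kappa> (x, t)) = 0"
proof -
  define q where "q = pos \<kappa> (x, t)"
  define v where "v = sqrt (sq_speed \<kappa> (x, t))"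
  define S where "S = unit_tangent \<kappa> (x, t)"
  define Y where "Y = velocity \<kappa> (x, t)"
  define D where "D a b w = dir_deriv (chart_img \<kappa>) (\<lambda>q. g \<kappa> t q a b) q w" for a b w
  define \<Gamma> where "\<Gamma> = christoffel (chart_img \<kappa>) (g \<kappa> t) q (tangent \<kappa> (x, t)) S"
  note facts = xt_facts[OF xt, folded q_def]
  have form: "inner_product_form (g \<kappa> t q')" if "q' \<in> chart_img \<kappa>" for q'
    using g_form[OF \<kappa> facts(1) that] .
  note simps = form_simps[OF facts(3)]
  have X: "tangent \<kappa> (x, t) = v *\<^sub>R S"
    using tangent_eq[OF xt] by (simp add: v_def S_def)
  have v: "v > 0" using sq_speed_pos[OF xt] by (simp add: v_def)
  obtain S' where S': "((\<lambda>y. unit_tangent \<kappa> (y, t)) has_vector_derivative S') (at x)"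
    using unit_tangent_differentiable[OF xt] by blast
  have "((\<lambda>y. g \<kappa> t (pos \<kappa> (y, t)) (unit_tangent \<kappa> (y, t)) (unit_tangent \<kappa> (y, t)))
      has_real_derivative D S S (v *\<^sub>R S) + g \<kappa> t q S' S + g \<kappa> t q S S') (at x)"
    using form_derivative_x[OF xt S' S'] unfolding X D_def q_def S_def .
  moreover have "((\<lambda>y. g \<kappa> t (pos \<kappa> (y, t)) (unit_tangent \<kappa> (y, t)) (unit_tangent \<kappa> (y, t)))
      has_real_derivative 0) (at x)"
    by (rule has_field_derivative_transform_within_open[OF DERIV_const[of 1] row_open])
      (use xt unit_tangent_norm in auto)
  ultimately have unit: "D S S (v *\<^sub>R S) + 2 * g \<kappa> t q S' S = 0"
    using DERIV_unique form_sym[OF facts(3), of S S'] by fastforce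
  have "2 * g \<kappa> t q \<Gamma> S = D S S (v *\<^sub>R S) + D (v *\<^sub>R S) S S - D (v *\<^sub>R S) S S"
    unfolding \<Gamma>_def D_def X[symmetric] using thick_img(1)[OF \<kappa>] facts(1,2) form
      g_differentiable[OF \<kappa>] by (intro christoffel_Koszul) blast+
  moreover have "v * g \<kappa> t q Y S = g \<kappa> t q (S' + \<Gamma>) S"
    unfolding \<Gamma>_def S_def Y_def q_def velocity_christoffel[OF xt S', symmetric]
    using simps by (simp add: v_def q_def)
  ultimately have "v * g \<kappa> t q Y S = 0"
    using unit by (simp add: simps)
  then show ?thesis
    using v by (simp add: q_def S_def Y_def)
qed

text \<open>Differentiating g(H,S) = 0 moves the derivative from H onto S, and \<nabla>_X S = |X| H.
  The left side is the time derivative of |X|^2 with the metric frozen in time, that is, 2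
  g(\<nabla>_X H, X).\<close>

lemma velocity_x_tangent:
  assumes xt: "(x, t) \<in> chart_region \<kappa>"
  shows "dir_deriv (chart_img \<kappa>) (\<lambda>q. g \<kappa> t q (tangent \<kappa> (x, t)) (tangent \<kappa> (x, t))) (pos \<kappa> (x, t))
      (velocity \<kappa> (x, t)) + 2 * g \<kappa> t (pos \<kappa> (x, t)) (velocity_x \<kappa> (x, t)) (tangent \<kappa> (x, t)) =
    - 2 * sq_speed \<kappa> (x, t) * sq_curv \<kappa> (x, t)"
proof -
  define q where "q = pos \<kappa> (x, t)"
  define v where "v = sqrt (sq_speed \<kappa> (x, t))"
  define S where "S = unit_tangent \<kappa> (x, t)"
  define Y where "Y = velocity \<kappa> (x, t)"
  define Yx where "Yx = velocity_x \<kappa> (x, t)"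
  define D where "D a b w = dir_deriv (chart_img \<kappa>) (\<lambda>q. g \<kappa> t q a b) q w" for a b w
  define \<Gamma> where "\<Gamma> = christoffel (chart_img \<kappa>) (g \<kappa> t) q (tangent \<kappa> (x, t)) S"
  note facts = xt_facts[OF xt, folded q_def]
  have form: "inner_product_form (g \<kappa> t q')" if "q' \<in> chart_img \<kappa>" for q'
    using g_form[OF \<kappa> facts(1) that] .
  note simps = form_simps[OF facts(3)]
  have X: "tangent \<kappa> (x, t) = v *\<^sub>R S"
    using tangent_eq[OF xt] by (simp add: v_def S_def)
  have bil: "bilinear (\<lambda>a b. D a b w)" for w
    unfolding D_def using thick_img(1)[OF \<kappa>] facts(1,2) form_bilinear[OF form]
      g_differentiable[OF \<kappa>] by (intro bilinear_dir_deriv) blast+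
  have lin: "linear (D a b)" for a b
    unfolding D_def[abs_def]
    using has_derivative_linear[OF dir_deriv_works[OF g_differentiable[OF \<kappa> facts(2,1)]]] .
  note D_simps = linear_scale[OF lin] bilinear_lmul[OF bil] bilinear_rmul[OF bil]
  have D_sym: "D Y S w = D S Y w" for w
  proof -
    have "((\<lambda>q. g \<kappa> t q Y S) has_derivative D S Y) (at q within chart_img \<kappa>)"
      using has_derivative_transform[OF facts(2) _ dir_deriv_works[OF g_differentiable[OF \<kappa> facts(2,1)]],
          of "\<lambda>q. g \<kappa> t q Y S" S Y] form_sym[OF form, of _ Y S] unfolding D_def[abs_def] by blast
    from dir_deriv_eqI[OF thick_img(1)[OF \<kappa>] facts(2) this, of w] show ?thesis
      by (simp only: D_def)
  qed
  obtain S' where S': "((\<lambda>y. unit_tangent \<kappa> (y, t)) has_vector_derivative S') (at x)"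
    using unit_tangent_differentiable[OF xt] by blast
  have Y': "((\<lambda>y. velocity \<kappa> (y, t)) has_vector_derivative Yx) (at x)"
    unfolding Yx_def velocity_x_def
    using region_partial_x[OF \<kappa> velocity_smooth[OF \<kappa>] xt] by simp
  have "((\<lambda>y. g \<kappa> t (pos \<kappa> (y, t)) (velocity \<kappa> (y, t)) (unit_tangent \<kappa> (y, t)))
      has_real_derivative D Y S (v *\<^sub>R S) + g \<kappa> t q Yx S + g \<kappa> t q Y S') (at x)"
    using form_derivative_x[OF xt Y' S'] unfolding X D_def q_def S_def Y_def .
  moreover have "((\<lambda>y. g \<kappa> t (pos \<kappa> (y, t)) (velocity \<kappa> (y, t)) (unit_tangent \<kappa> (y, t)))
      has_real_derivative 0) (at x)"
    by (rule has_field_derivative_transform_within_open[OF DERIV_const[of 0] row_open])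
      (use xt velocity_normal in auto)
  ultimately have normal: "v * D S Y S + g \<kappa> t q Yx S + g \<kappa> t q S' Y = 0"
    using DERIV_unique form_sym[OF facts(3), of Y S'] by (fastforce simp: D_simps D_sym)
  \<comment> \<open>Koszul's formula with w = Y produces the same term \<open>D S Y S\<close> as
    \<open>normal\<close>; it cancels in the sum, and S' is eliminated with it.\<close>
  have "2 * g \<kappa> t q \<Gamma> Y = D S Y (v *\<^sub>R S) + D (v *\<^sub>R S) Y S - D (v *\<^sub>R S) S Y"
    unfolding \<Gamma>_def D_def X[symmetric] using thick_img(1)[OF \<kappa>] facts(1,2) form
      g_differentiable[OF \<kappa>] by (intro christoffel_Koszul) blast+
  then have \<Gamma>: "2 * g \<kappa> t q \<Gamma> Y = 2 * v * D S Y S - v * D S S Y"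
    by (simp add: D_simps)
  have "v * g \<kappa> t q Y Y = g \<kappa> t q (S' + \<Gamma>) Y"
    unfolding \<Gamma>_def S_def Y_def q_def velocity_christoffel[OF xt S', symmetric]
    using simps by (simp add: v_def q_def)
  then have "v * g \<kappa> t q Y Y = g \<kappa> t q S' Y + g \<kappa> t q \<Gamma> Y"
    by (simp add: simps)
  with normal \<Gamma> have "v * D S S Y + 2 * g \<kappa> t q Yx S = - 2 * v * g \<kappa> t q Y Y"
    by linarith
  \<comment> \<open>Multiplication by v turns S into X = v S.\<close>
  then have "v * (v * D S S Y + 2 * g \<kappa> t q Yx S) = v * (- 2 * v * g \<kappa> t q Y Y)"
    by simp
  then have "D (v *\<^sub>R S) (v *\<^sub>R S) Y + 2 * g \<kappa> t q Yx (v *\<^sub>R S) = - 2 * (v * v) * g \<kappa> t q Y Y"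
    by (simp add: D_simps simps algebra_simps)
  moreover have "v * v = sq_speed \<kappa> (x, t)"
    using sq_speed_pos[OF xt] by (simp add: v_def)
  ultimately show ?thesis
    unfolding X D_def q_def Y_def Yx_def sq_curv_def by simp
qed

text \<open>The product rule is applied over space times time at the point (pos,s), which moves with
  velocity (H,1). The space part is \<open>velocity_x_tangent\<close>, the time part is the Ricci
  flow equation.\<close>

lemma sq_speed_evolution:
  assumes xt: "(x, t) \<in> chart_region \<kappa>"
  shows "((\<lambda>s. sq_speed \<kappa> (x, s)) has_real_derivative
    - 2 * sq_speed \<kappa> (x, t) * sq_curv \<kappa> (x, t)
      - 2 * Ric g \<kappa> t (pos \<kappa> (x, t)) (tangent \<kappa> (x, t)) (tangent \<kappa> (x, t))) (at t within {0..T})"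
proof -
  note facts = xt_facts[OF xt]
  let ?J = "{s. (x, s) \<in> chart_region \<kappa>}"
  let ?Z = "chart_img \<kappa> \<times> {0..T}"
  let ?G = "\<lambda>z. g \<kappa> (snd z) (fst z)"
  let ?X = "tangent \<kappa> (x, t)"
  have J: "at t within ?J = at t within {0..T}" by (rule column_filter[OF xt])
  have pos': "((\<lambda>s. pos \<kappa> (x, s)) has_vector_derivative velocity \<kappa> (x, t)) (at t within {0..T})"
    unfolding velocity_def using region_partial_t[OF \<kappa> pos_smooth[OF \<kappa>] xt] .
  have z': "((\<lambda>s. (pos \<kappa> (x, s), s)) has_vector_derivative (velocity \<kappa> (x, t), 1)) (at t within ?J)"
    unfolding J by (intro has_vector_derivative_Pair pos' has_vector_derivative_id)
  have X': "((\<lambda>s. tangent \<kappa> (x, s)) has_vector_derivative velocity_x \<kappa> (x, t)) (at t within ?J)"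
    unfolding J by (rule tangent_t[OF \<kappa> xt])
  have "((\<lambda>s. ?G (pos \<kappa> (x, s), s) (tangent \<kappa> (x, s)) (tangent \<kappa> (x, s))) has_real_derivative
      dir_deriv ?Z (\<lambda>q. ?G q ?X ?X) (pos \<kappa> (x, t), t) (velocity \<kappa> (x, t), 1) +
      ?G (pos \<kappa> (x, t), t) (velocity_x \<kappa> (x, t)) ?X +
      ?G (pos \<kappa> (x, t), t) ?X (velocity_x \<kappa> (x, t))) (at t within ?J)"
  proof (rule form_has_real_derivative[OF thick_img(2)[OF \<kappa>] _ _ _ _ z' X' X'])
    show "bilinear (?G q)" if "q \<in> ?Z" for q
      using that form_bilinear[OF g_form[OF \<kappa>]] by auto
    show "(\<lambda>s. (pos \<kappa> (x, s), s)) ` ?J \<subseteq> ?Z"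
      using pos_in[OF \<kappa>] region_time[OF \<kappa>] by auto
    show "(\<lambda>q. ?G q a b) differentiable at (pos \<kappa> (x, t), t) within ?Z" for a b
      using differentiableI[OF g_has_derivative[OF \<kappa> facts(2,1)]] by (simp add: case_prod_beta')
  qed (use xt in simp)
  moreover have "dir_deriv ?Z (\<lambda>q. ?G q ?X ?X) (pos \<kappa> (x, t), t) (velocity \<kappa> (x, t), 1) =
      dir_deriv (chart_img \<kappa>) (\<lambda>q. g \<kappa> t q ?X ?X) (pos \<kappa> (x, t)) (velocity \<kappa> (x, t))
        - 2 * Ric g \<kappa> t (pos \<kappa> (x, t)) ?X ?X"
    using g_dir_deriv[OF \<kappa> facts(2,1)] by (simp add: case_prod_beta')
  moreover have "?G (pos \<kappa> (x, t), t) ?X (velocity_x \<kappa> (x, t)) =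
      ?G (pos \<kappa> (x, t), t) (velocity_x \<kappa> (x, t)) ?X"
    using form_sym[OF facts(3)] by simp
  ultimately show ?thesis
    using velocity_x_tangent[OF xt] unfolding J sq_speed_def
    by (simp add: algebra_simps)
qed

text \<open>H is orthogonal to S and has no time component. Hence removing the S-component of
  \<nabla>_S H does not change its product with H, and the time component of \<nabla>_S H is
  invisible to that product. The factor |X|^2 appears because the derivative is taken in x and not
  in arc length.\<close>

lemma curvature_gradient_bound:
  assumes xt: "(x, t) \<in> chart_region \<kappa>"
    and N: "N = nabla_S_H_perp_in g \<kappa> {0..T} c x t"
  shows "(dir_deriv (chart_region \<kappa>) (sq_curv \<kappa>) (x, t) (1, 0))\<^sup>2 \<le>
    4 * sq_speed \<kappa> (x, t) * sq_curv \<kappa> (x, t) * spacetime_metric g \<kappa> (curve_in \<kappa> c x t, t) N N"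
    and "0 \<le> spacetime_metric g \<kappa> (curve_in \<kappa> c x t, t) N N"
proof -
  define q where "q = pos \<kappa> (x, t)"
  define v where "v = sqrt (sq_speed \<kappa> (x, t))"
  define S where "S = unit_tangent \<kappa> (x, t)"
  define X where "X = tangent \<kappa> (x, t)"
  define Y where "Y = velocity \<kappa> (x, t)"
  define Yx where "Yx = velocity_x \<kappa> (x, t)"
  note facts = xt_facts[OF xt, folded q_def]
  let ?Z = "chart_img \<kappa> \<times> {0..T}"
  let ?h = "spacetime_metric g \<kappa>"
  have v: "v > 0" "v\<^sup>2 = sq_speed \<kappa> (x, t)"
    using sq_speed_pos[OF xt] by (simp_all add: v_def)
  have h_form: "inner_product_form (?h z)" if "z \<in> ?Z" for z
  proof -
    obtain q s where z: "z = (q, s)" "q \<in> chart_img \<kappa>" "s \<in> {0..T}"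
      using \<open>z \<in> ?Z\<close> by blast
    note form = g_form[OF \<kappa> z(3,2)]
    have "0 < ?h z u u" if "u \<noteq> 0" for u
    proof (cases "fst u = 0")
      case True
      then have "snd u \<noteq> 0" using that by (simp add: prod_eq_iff)
      then have "0 < snd u * snd u" by (auto simp: zero_less_mult_iff)
      then show ?thesis
        using form_nonneg[OF form, of "fst u"]
        by (simp add: spacetime_metric_def z)
    next
      case False
      then show ?thesis
        using form_pos[OF form False] by (simp add: spacetime_metric_def z add_pos_nonneg)
    qed
    moreover have "bilinear (?h z)"
      unfolding bilinear_def spacetime_metric_def z
      by (auto intro!: linearI simp: form_simps[OF form] algebra_simps)
    ultimately show ?thesis
      unfolding inner_product_form_def
      using form_sym[OF form] by (auto simp: spacetime_metric_def z mult.commute)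
  qed
  have z: "(q, t) \<in> ?Z" using facts by simp
  note simps = form_simps[OF h_form[OF z]]
  have h_has_derivative: "((\<lambda>z. ?h z a b) has_derivative
      dir_deriv ?Z (\<lambda>(q, t). g \<kappa> t q (fst a) (fst b)) (q, t)) (at (q, t) within ?Z)" for a b
    using has_derivative_add[OF g_has_derivative[OF \<kappa> facts(2,1)] has_derivative_const,
        of "fst a" "fst b" "snd a * snd b"]
    by (simp add: spacetime_metric_def case_prod_beta')
  define W where "W = nabla_S_H_in g \<kappa> {0..T} c x t"
  define \<Gamma> where "\<Gamma> = christoffel ?Z ?h (q, t) (X, 0) (Y, 0)"
  have Y': "((\<lambda>y. velocity \<kappa> (y, t)) has_vector_derivative Yx) (at x)"
    unfolding Yx_def velocity_x_def
    using region_partial_x[OF \<kappa> velocity_smooth[OF \<kappa>] xt] by simp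
  then have H': "((\<lambda>y. H_in g \<kappa> c y t) has_vector_derivative Yx) (at x)"
    by (rule has_vector_derivative_transform_within_open[OF _ row_open])
      (use xt H_in_eq[OF \<kappa>] in auto)
  have X': "((\<lambda>y. pos \<kappa> (y, t)) has_vector_derivative X) (at x)"
    unfolding X_def tangent_def using region_partial_x[OF \<kappa> pos_smooth[OF \<kappa>] xt] .
  have "vector_derivative (\<lambda>y. (H_in g \<kappa> c y t, 0 :: real)) (at x) = (Yx, 0)"
    "vector_derivative (\<lambda>y. (pos \<kappa> (y, t), t)) (at x) = (X, 0)"
    by (intro vector_derivative_at has_vector_derivative_Pair H' X' has_vector_derivative_const)+
  then have W: "v *\<^sub>R W = (Yx, 0) + \<Gamma>"
    unfolding W_def nabla_S_H_in_def cov_deriv_along_def norm_X_in[OF xt] \<Gamma>_def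
    using v(1) by (simp add: curve_in_eq[OF \<kappa>] H_in_eq[OF \<kappa> xt] q_def Y_def v_def)
  \<comment> \<open>With w equal to the second argument (Y,0) the last two Koszul terms cancel. Only
    the derivative along (X,0) survives, so time derivatives of g do not enter.\<close>
  have "2 * ?h (q, t) \<Gamma> (Y, 0) = dir_deriv ?Z (\<lambda>z. ?h z (Y, 0) (Y, 0)) (q, t) (X, 0)
      + dir_deriv ?Z (\<lambda>z. ?h z (X, 0) (Y, 0)) (q, t) (Y, 0)
      - dir_deriv ?Z (\<lambda>z. ?h z (X, 0) (Y, 0)) (q, t) (Y, 0)"
    unfolding \<Gamma>_def using thick_img(2)[OF \<kappa>] z h_form differentiableI[OF h_has_derivative]
    by (intro christoffel_Koszul) blast+
  also have "\<dots> = dir_deriv (chart_img \<kappa>) (\<lambda>q. g \<kappa> t q Y Y) q X"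
    using dir_deriv_eqI[OF thick_img(2)[OF \<kappa>] z h_has_derivative, of "(Y, 0)" "(Y, 0)"]
      g_dir_deriv_space[OF \<kappa> facts(2,1), of Y Y X] by simp
  finally have \<Gamma>: "2 * ?h (q, t) \<Gamma> (Y, 0) = dir_deriv (chart_img \<kappa>) (\<lambda>q. g \<kappa> t q Y Y) q X" .
  have "((\<lambda>y. sq_curv \<kappa> (y, t)) has_real_derivative
      dir_deriv (chart_img \<kappa>) (\<lambda>q. g \<kappa> t q Y Y) q X + g \<kappa> t q Yx Y + g \<kappa> t q Y Yx) (at x)"
    unfolding sq_curv_def using form_derivative_x[OF xt Y' Y'] by (simp add: q_def Y_def X_def)
  moreover have "((\<lambda>y. sq_curv \<kappa> (y, t)) has_real_derivative
      dir_deriv (chart_region \<kappa>) (sq_curv \<kappa>) (x, t) (1, 0)) (at x)"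
    unfolding has_real_derivative_iff_has_vector_derivative
    using region_partial_x[OF \<kappa> sq_curv_smooth xt] .
  ultimately have Qx: "dir_deriv (chart_region \<kappa>) (sq_curv \<kappa>) (x, t) (1, 0) =
      2 * ?h (q, t) (v *\<^sub>R W) (Y, 0)"
    using DERIV_unique \<Gamma> form_sym[OF facts(3), of Y Yx] unfolding W
    by (fastforce simp: simps spacetime_metric_def[of g \<kappa> "(q, t)" "(Yx, 0)"])
  have "?h (q, t) (S, 0) (Y, 0) = 0"
    using velocity_normal[OF xt] form_sym[OF facts(3), of S Y]
    by (simp add: spacetime_metric_def q_def S_def Y_def)
  moreover have N_eq: "N = W - ?h (q, t) W (S, 0) *\<^sub>R (S, 0)"
    unfolding N nabla_S_H_perp_in_def Let_def W_def[symmetric] S_in_eq[OF xt]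
    by (simp add: curve_in_eq[OF \<kappa>] q_def S_def)
  ultimately have "?h (q, t) N (Y, 0) = ?h (q, t) W (Y, 0)"
    unfolding N_eq by (simp only: simps) simp
  then have "dir_deriv (chart_region \<kappa>) (sq_curv \<kappa>) (x, t) (1, 0) = 2 * v * ?h (q, t) N (Y, 0)"
    unfolding Qx by (simp only: simps) simp
  then have "(dir_deriv (chart_region \<kappa>) (sq_curv \<kappa>) (x, t) (1, 0))\<^sup>2 =
      4 * sq_speed \<kappa> (x, t) * (?h (q, t) N (Y, 0))\<^sup>2"
    by (simp add: power_mult_distrib v(2))
  also have "\<dots> \<le> 4 * sq_speed \<kappa> (x, t) * (?h (q, t) N N * ?h (q, t) (Y, 0) (Y, 0))"
    using form_Cauchy_Schwarz[OF h_form[OF z], of N "(Y, 0)"] sq_speed_pos[OF xt] by simp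
  also have "?h (q, t) (Y, 0) (Y, 0) = sq_curv \<kappa> (x, t)"
    by (simp add: spacetime_metric_def sq_curv_def q_def Y_def)
  finally show "(dir_deriv (chart_region \<kappa>) (sq_curv \<kappa>) (x, t) (1, 0))\<^sup>2 \<le>
    4 * sq_speed \<kappa> (x, t) * sq_curv \<kappa> (x, t) * ?h (curve_in \<kappa> c x t, t) N N"
    by (simp add: curve_in_eq[OF \<kappa>] q_def mult_ac)
  show "0 \<le> ?h (curve_in \<kappa> c x t, t) N N"
    using form_nonneg[OF h_form[OF z]] by (simp add: curve_in_eq[OF \<kappa>] q_def)
qed

end

end

section \<open>Chart independence\<close>

lemma has_vector_derivative_periodic:
  assumes "(f has_vector_derivative d) (at x)" "\<And>y. f (y + p) = f y"
  shows "(f has_vector_derivative d) (at (x + p :: real))"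
proof -
  have "((\<lambda>y. y - p) has_vector_derivative 1) (at (x + p))"
    by (auto intro!: derivative_eq_intros)
  then have "((f \<circ> (\<lambda>y. y - p)) has_vector_derivative 1 *\<^sub>R d) (at (x + p))"
    by (rule vector_diff_chain_at) (use assms(1) in simp)
  moreover have "f \<circ> (\<lambda>y. y - p) = f"
    using assms(2)[of "_ - p"] by (simp add: fun_eq_iff)
  ultimately show ?thesis by simp
qed

context shrinking_flow
begin

lemma chart_at:
  shows "chart_at A p \<in> A" "p \<in> chart_dom (chart_at A p)"
proof -
  have "\<exists>\<kappa>. \<kappa> \<in> A \<and> p \<in> chart_dom \<kappa>"
    using atlas unfolding smooth_atlas_def by blast
  from someI_ex[OF this] show "chart_at A p \<in> A" "p \<in> chart_dom (chart_at A p)"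
    unfolding chart_at_def by blast+
qed

lemma chart_at_region: "t \<in> {0..T} \<Longrightarrow> (x, t) \<in> chart_region (chart_at A (c x t))"
  using chart_at(2) by (simp add: chart_region_def)

lemma overlap_open:
  assumes "\<kappa> \<in> A" "\<kappa>' \<in> A"
  shows "open (overlap \<kappa> \<kappa>')"
proof -
  have "openin (top_of_set (chart_img \<kappa>)) (coord \<kappa> ` (chart_dom \<kappa> \<inter> chart_dom \<kappa>'))"
    by (rule homeomorphism_imp_open_map[OF chart(3)[OF assms(1)]])
      (use chart(1)[OF assms(2)] in \<open>auto simp: openin_open\<close>)
  then show ?thesis
    using openin_open_eq[OF chart(2)[OF assms(1)]] unfolding overlap_def by blast
qed

lemma pos_transition:
  assumes "\<kappa> \<in> A" "z \<in> chart_region \<kappa>" "z \<in> chart_region \<kappa>'"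
  shows "pos \<kappa> z \<in> overlap \<kappa> \<kappa>'" "transition \<kappa> \<kappa>' (pos \<kappa> z) = pos \<kappa>' z"
proof -
  obtain x t where z: "z = (x, t)" "c x t \<in> chart_dom \<kappa>" "c x t \<in> chart_dom \<kappa>'"
    using assms unfolding chart_region_def by auto
  then show "pos \<kappa> z \<in> overlap \<kappa> \<kappa>'"
    unfolding overlap_def pos_def by auto
  have "param \<kappa> (coord \<kappa> (c x t)) = c x t"
    using chart(3)[OF assms(1)] z unfolding homeomorphism_def by blast
  then show "transition \<kappa> \<kappa>' (pos \<kappa> z) = pos \<kappa>' z"
    by (simp add: z transition_def pos_def)
qed

text \<open>The chain rule for the change of charts, with an arbitrary direction h so that tangent
  and velocity obey the same law. Both are first derivatives, so no second derivative of the
  transition map occurs.\<close>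

lemma pos_derivative_transition:
  assumes \<kappa>: "\<kappa> \<in> A" "\<kappa>' \<in> A" and z: "z \<in> chart_region \<kappa>" "z \<in> chart_region \<kappa>'"
  shows "dir_deriv (chart_region \<kappa>') (pos \<kappa>') z h =
    dir_deriv (overlap \<kappa> \<kappa>') (transition \<kappa> \<kappa>') (pos \<kappa> z) (dir_deriv (chart_region \<kappa>) (pos \<kappa>) z h)"
proof -
  let ?R = "chart_region \<kappa> \<inter> chart_region \<kappa>'"
  have "Ck_on (Suc 0) (overlap \<kappa> \<kappa>') (transition \<kappa> \<kappa>')"
    using atlas \<kappa> unfolding smooth_atlas_def smooth_on_def by blast
  then have tr: "(transition \<kappa> \<kappa>' has_derivative
      dir_deriv (overlap \<kappa> \<kappa>') (transition \<kappa> \<kappa>') (pos \<kappa> z)) (at (pos \<kappa> z) within overlap \<kappa> \<kappa>')"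
    using Ck_on_dir_deriv(2) thick_open[OF overlap_open[OF \<kappa>]] pos_transition(1)[OF \<kappa>(1) z] by blast
  have pos': "(pos \<mu> has_derivative dir_deriv (chart_region \<mu>) (pos \<mu>) z) (at z within ?R)"
    if "\<mu> \<in> {\<kappa>, \<kappa>'}" for \<mu>
  proof -
    have \<mu>: "\<mu> \<in> A" "z \<in> chart_region \<mu>" using that \<kappa> z by auto
    show ?thesis
      by (rule has_derivative_subset[OF Ck_on_dir_deriv(2)[OF thick_chart_region[OF \<mu>(1)]
            pos_smooth[OF \<mu>(1)] \<mu>(2)]]) (use that in auto)
  qed
  have "((\<lambda>z. transition \<kappa> \<kappa>' (pos \<kappa> z)) has_derivative
      (\<lambda>h. dir_deriv (overlap \<kappa> \<kappa>') (transition \<kappa> \<kappa>') (pos \<kappa> z)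
        (dir_deriv (chart_region \<kappa>) (pos \<kappa>) z h))) (at z within ?R)"
    by (rule has_derivative_in_compose[OF pos'[of \<kappa>, simplified] has_derivative_subset[OF tr]])
      (use pos_transition(1)[OF \<kappa>(1)] in blast)
  then have "(pos \<kappa>' has_derivative
      (\<lambda>h. dir_deriv (overlap \<kappa> \<kappa>') (transition \<kappa> \<kappa>') (pos \<kappa> z)
        (dir_deriv (chart_region \<kappa>) (pos \<kappa>) z h))) (at z within ?R)"
    by (rule has_derivative_transform[rotated 2]) (use z pos_transition(2)[OF \<kappa>(1)] in auto)
  moreover have "thick ?R"
  proof -
    obtain W where "open W" "chart_region \<kappa>' = (UNIV \<times> {0..T}) \<inter> W"
      using chart_region_open[OF \<kappa>(2)] by blast
    moreover from this have "?R = chart_region \<kappa> \<inter> W"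
      unfolding chart_region_def by auto
    ultimately show ?thesis
      using thick_Int_open[OF thick_chart_region[OF \<kappa>(1)]] by simp
  qed
  ultimately show ?thesis
    using thick_unique[of ?R z "pos \<kappa>'"] pos'[of \<kappa>'] z by (metis IntI insertI1 insertI2)
qed

lemma chart_independence:
  assumes \<kappa>: "\<kappa> \<in> A" "\<kappa>' \<in> A" and z: "z \<in> chart_region \<kappa>" "z \<in> chart_region \<kappa>'"
  shows "sq_speed \<kappa> z = sq_speed \<kappa>' z" "sq_curv \<kappa> z = sq_curv \<kappa>' z"
proof -
  have t: "snd z \<in> {0..T}" using z(1) region_time[OF \<kappa>(1)] by (metis prod.collapse)
  have "g \<kappa> (snd z) (pos \<kappa> z) u v = g \<kappa>' (snd z) (pos \<kappa>' z)
      (dir_deriv (overlap \<kappa> \<kappa>') (transition \<kappa> \<kappa>') (pos \<kappa> z) u)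
      (dir_deriv (overlap \<kappa> \<kappa>') (transition \<kappa> \<kappa>') (pos \<kappa> z) v)" for u v
    using metrics \<kappa> t pos_transition[OF \<kappa>(1) z] unfolding smooth_metrics_def by metis
  then show "sq_speed \<kappa> z = sq_speed \<kappa>' z" "sq_curv \<kappa> z = sq_curv \<kappa>' z"
    unfolding sq_speed_def sq_curv_def tangent_def velocity_def
    using pos_derivative_transition[OF \<kappa> z] by simp_all
qed

text \<open>\<open>speed\<close> and \<open>curv\<close> use a chart that varies with the point.
  Near a given point they can now be computed in one fixed chart, and so be differentiated.\<close>

lemma
  assumes "\<kappa> \<in> A" "(x, t) \<in> chart_region \<kappa>"
  shows speed_sq_eq: "(speed A g c x t)\<^sup>2 = sq_speed \<kappa> (x, t)"
    and curv_sq_eq: "(curv A g c x t)\<^sup>2 = sq_curv \<kappa> (x, t)"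
proof -
  let ?\<kappa> = "chart_at A (c x t)"
  have xt: "(x, t) \<in> chart_region ?\<kappa>"
    using chart_at_region region_time[OF assms] by blast
  show "(speed A g c x t)\<^sup>2 = sq_speed \<kappa> (x, t)"
    unfolding speed_def Let_def norm_X_in[OF chart_at(1) xt]
    using sq_speed_pos[OF chart_at(1) xt] chart_independence(1)[OF chart_at(1) assms(1) xt assms(2)]
    by simp
  show "(curv A g c x t)\<^sup>2 = sq_curv \<kappa> (x, t)"
    unfolding curv_def Let_def norm_H_in[OF chart_at(1) xt]
    using sq_curv_nonneg[OF chart_at(1) xt] chart_independence(2)[OF chart_at(1) assms(1) xt assms(2)]
    by simp
qed

lemma speed_pos: "t \<in> {0..T} \<Longrightarrow> 0 < speed A g c x t"
  unfolding speed_def Let_def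
  using norm_X_in[OF chart_at(1) chart_at_region] sq_speed_pos[OF chart_at(1) chart_at_region] by simp

lemma curv_nonneg: "t \<in> {0..T} \<Longrightarrow> 0 \<le> curv A g c x t"
  unfolding curv_def Let_def
  using norm_H_in[OF chart_at(1) chart_at_region] sq_curv_nonneg[OF chart_at(1) chart_at_region] by simp

text \<open>Chartwise smooth expressions are glued by \<open>Ck_on_local\<close>, with the region of
  the chart chosen at a point as its neighbourhood.\<close>

lemma strip_smooth:
  assumes "\<And>\<kappa>. \<kappa> \<in> A \<Longrightarrow> Ck_on k (chart_region \<kappa>) (F \<kappa>)"
    and "\<And>\<kappa> x t. \<kappa> \<in> A \<Longrightarrow> (x, t) \<in> chart_region \<kappa> \<Longrightarrow> f x t = F \<kappa> (x, t)"
  shows "Ck_on k (UNIV \<times> {0..T}) (\<lambda>(x, t). f x t)"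
proof (rule Ck_on_local)
  show "thick (UNIV \<times> {0..T})"
    by (intro thick_Times thick_UNIV thick_interval T_pos)
  fix z :: "real \<times> real" assume z: "z \<in> UNIV \<times> {0..T}"
  obtain x t where xt: "z = (x, t)" by (cases z)
  let ?\<kappa> = "chart_at A (c x t)"
  obtain W where W: "open W" "chart_region ?\<kappa> = (UNIV \<times> {0..T}) \<inter> W"
    using chart_region_open[OF chart_at(1)] by blast
  have "z \<in> W"
    using chart_at_region z xt W(2) by blast
  moreover have "Ck_on k ((UNIV \<times> {0..T}) \<inter> W) (\<lambda>(x, t). f x t)"
    unfolding W(2)[symmetric]
    by (rule Ck_on_cong[OF assms(1)[OF chart_at(1)]]) (use assms(2)[OF chart_at(1)] in auto)
  ultimately show "\<exists>W. open W \<and> z \<in> W \<and> Ck_on k ((UNIV \<times> {0..T}) \<inter> W) (\<lambda>(x, t). f x t)"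
    using W(1) by blast
qed

section \<open>Speed and curvature as functions on the whole strip\<close>

lemma speed_sq_smooth: "Ck_on k (UNIV \<times> {0..T}) (\<lambda>(x, t). (speed A g c x t)\<^sup>2)"
  using strip_smooth[OF sq_speed_smooth] speed_sq_eq by simp

lemma curv_sq_smooth: "Ck_on k (UNIV \<times> {0..T}) (\<lambda>(x, t). (curv A g c x t)\<^sup>2)"
  using strip_smooth[OF sq_curv_smooth] curv_sq_eq by simp

text \<open>The Ricci bound is unfolded only here, to give |Ric(X,X)| \<le> C2 |X|^2. The derivative
  is an expression in a chart, hence the existential.\<close>

lemma speed_sq_evolution:
  assumes C2: "ricci_norm_bound A {0..T} g C2" and t: "t \<in> {0..T}"
  shows "\<exists>d. ((\<lambda>s. (speed A g c x s)\<^sup>2) has_real_derivative d) (at t within {0..T}) \<and>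
    d \<le> 2 * (C2 - (curv A g c x t)\<^sup>2) * (speed A g c x t)\<^sup>2"
proof -
  let ?\<kappa> = "chart_at A (c x t)"
  note \<kappa> = chart_at(1)[of "c x t"]
  note xt = chart_at_region[OF t, of x]
  let ?q = "pos ?\<kappa> (x, t)" and ?X = "tangent ?\<kappa> (x, t)"
  note facts = xt_facts[OF \<kappa> xt]
  let ?J = "{s. (x, s) \<in> chart_region ?\<kappa>}"
  have deriv: "((\<lambda>s. (speed A g c x s)\<^sup>2) has_real_derivative
      - 2 * sq_speed ?\<kappa> (x, t) * sq_curv ?\<kappa> (x, t) - 2 * Ric g ?\<kappa> t ?q ?X ?X) (at t within ?J)"
    by (rule has_field_derivative_transform_within[OF
          sq_speed_evolution[OF \<kappa> xt, folded column_filter[OF \<kappa> xt]], of 1])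
      (use xt speed_sq_eq[OF \<kappa>] in auto)
  have "- 2 * Ric g ?\<kappa> t ?q ?X ?X \<le> 2 * C2 * sq_speed ?\<kappa> (x, t)"
  proof -
    have "\<bar>Ric g ?\<kappa> t ?q ?X ?X\<bar> \<le> tensor_norm (g ?\<kappa> t ?q) (Ric g ?\<kappa> t ?q) * g ?\<kappa> t ?q ?X ?X"
      by (rule abs_le_tensor_norm[OF facts(3) Ric_bilinear[OF \<kappa> facts(2,1)]])
    also have "\<dots> \<le> C2 * g ?\<kappa> t ?q ?X ?X"
      using C2 \<kappa> facts form_nonneg[OF facts(3)] unfolding ricci_norm_bound_def
      by (intro mult_right_mono) auto
    finally show ?thesis by (simp add: sq_speed_def)
  qed
  moreover have "- 2 * p * k - 2 * r \<le> 2 * (C2 - k) * p" if "- 2 * r \<le> 2 * C2 * p" for p k r :: real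
    using that by (simp add: algebra_simps)
  ultimately have "- 2 * sq_speed ?\<kappa> (x, t) * sq_curv ?\<kappa> (x, t) - 2 * Ric g ?\<kappa> t ?q ?X ?X \<le>
      2 * (C2 - (curv A g c x t)\<^sup>2) * (speed A g c x t)\<^sup>2"
    unfolding speed_sq_eq[OF \<kappa> xt] curv_sq_eq[OF \<kappa> xt] by blast
  then show ?thesis
    using deriv unfolding column_filter[OF \<kappa> xt] by blast
qed

lemma curv_sq_gradient:
  assumes t: "t \<in> {0..T}" and d: "((\<lambda>y. (curv A g c y t)\<^sup>2) has_real_derivative d) (at x)"
  shows "d\<^sup>2 \<le> 4 * (speed A g c x t)\<^sup>2 * (curv A g c x t)\<^sup>2 * nabla_S_H_perp_sq A {0..T} g c x t"
    and "0 \<le> nabla_S_H_perp_sq A {0..T} g c x t"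
proof -
  let ?\<kappa> = "chart_at A (c x t)"
  note \<kappa> = chart_at(1)[of "c x t"]
  note xt = chart_at_region[OF t, of x]
  have "((\<lambda>y. sq_curv ?\<kappa> (y, t)) has_real_derivative d) (at x)"
    by (rule has_field_derivative_transform_within_open[OF d row_open[OF \<kappa>, of t]])
      (use xt curv_sq_eq[OF \<kappa>] in auto)
  moreover have "((\<lambda>y. sq_curv ?\<kappa> (y, t)) has_real_derivative
      dir_deriv (chart_region ?\<kappa>) (sq_curv ?\<kappa>) (x, t) (1, 0)) (at x)"
    unfolding has_real_derivative_iff_has_vector_derivative
    using region_partial_x[OF \<kappa> sq_curv_smooth[OF \<kappa>] xt] .
  ultimately have "d = dir_deriv (chart_region ?\<kappa>) (sq_curv ?\<kappa>) (x, t) (1, 0)"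
    by (rule DERIV_unique)
  then show "d\<^sup>2 \<le> 4 * (speed A g c x t)\<^sup>2 * (curv A g c x t)\<^sup>2 * nabla_S_H_perp_sq A {0..T} g c x t"
    using curvature_gradient_bound(1)[OF \<kappa> xt refl] unfolding nabla_S_H_perp_sq_def Let_def
      speed_sq_eq[OF \<kappa> xt] curv_sq_eq[OF \<kappa> xt] by simp
  show "0 \<le> nabla_S_H_perp_sq A {0..T} g c x t"
    using curvature_gradient_bound(2)[OF \<kappa> xt refl] unfolding nabla_S_H_perp_sq_def Let_def .
qed

lemma closed: "t \<in> {0..T} \<Longrightarrow> c (x + 2 * pi) t = c x t"
  using curves(1) unfolding smooth_closed_curves_def by blast

lemma speed_periodic:
  assumes t: "t \<in> {0..T}"
  shows "speed A g c (x + 2 * pi) t = speed A g c x t"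
proof -
  let ?\<kappa> = "chart_at A (c x t)"
  note \<kappa> = chart_at(1)[of "c x t"]
  note xt = chart_at_region[OF t, of x]
  have "((\<lambda>y. pos ?\<kappa> (y, t)) has_vector_derivative tangent ?\<kappa> (x, t)) (at (x + 2 * pi))"
    by (rule has_vector_derivative_periodic)
      (use region_partial_x[OF \<kappa> pos_smooth[OF \<kappa>] xt] closed[OF t] in
        \<open>auto simp: tangent_def pos_def\<close>)
  then have "X_in ?\<kappa> c (x + 2 * pi) t = tangent ?\<kappa> (x, t)"
    unfolding X_in_def curve_in_eq[OF \<kappa>] by (rule vector_derivative_at)
  then have "X_in ?\<kappa> c (x + 2 * pi) t = X_in ?\<kappa> c x t"
    unfolding X_in_eq[OF \<kappa> xt] .
  then show ?thesis
    unfolding speed_def closed[OF t] Let_def norm_in_def curve_in_def by simp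
qed

text \<open>H is the velocity, and since the curves close up at all times, the velocities at x and x
  + 2 pi agree.\<close>

lemma curv_periodic:
  assumes t: "t \<in> {0..T}"
  shows "curv A g c (x + 2 * pi) t = curv A g c x t"
proof -
  let ?\<kappa> = "chart_at A (c x t)"
  note \<kappa> = chart_at(1)[of "c x t"]
  note xt = chart_at_region[OF t, of x]
  have xt': "(x + 2 * pi, t) \<in> chart_region ?\<kappa>"
    using xt closed[OF t] unfolding chart_region_def by simp
  have "((\<lambda>s. pos ?\<kappa> (x + 2 * pi, s)) has_vector_derivative velocity ?\<kappa> (x, t)) (at t within {0..T})"
    by (rule has_vector_derivative_transform[OF t])
      (use region_partial_t[OF \<kappa> pos_smooth[OF \<kappa>] xt] closed in
        \<open>auto simp: velocity_def pos_def\<close>)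
  then have "velocity ?\<kappa> (x + 2 * pi, t) = velocity ?\<kappa> (x, t)"
    using region_partial_t[OF \<kappa> pos_smooth[OF \<kappa>] xt'] unfolding velocity_def[of _ "(x + 2 * pi, t)"]
    using vector_derivative_unique_within[OF at_within_interval_neq_bot[OF T_pos t]] by blast
  then show ?thesis
    unfolding curv_def closed[OF t] Let_def norm_in_def H_in_eq[OF \<kappa> xt] H_in_eq[OF \<kappa> xt']
    by (simp add: curve_in_def closed[OF t])
qed

end

section \<open>Evolution of integrals along the flow\<close>

lemma sqrt_has_real_derivative:
  assumes "(f has_real_derivative d) (at x within S)" "0 < f x"
  shows "((\<lambda>y. sqrt (f y)) has_real_derivative d / (2 * sqrt (f x))) (at x within S)"
proof -
  have "((\<lambda>y. sqrt (f y)) has_real_derivative inverse (sqrt (f x)) / 2 * d) (at x within S)"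
    using DERIV_chain2[OF DERIV_real_sqrt[OF assms(2)] assms(1)] .
  then show ?thesis by (simp add: field_simps)
qed

text \<open>The term z is an exact x-derivative and integrates to zero over a closed curve. So the
  integral F satisfies F' \<le> c F, and F(t) exp(-c t) does not increase, whatever the sign of
  c.\<close>

lemma integral_Gronwall:
  fixes f ft z Z :: "real \<Rightarrow> real \<Rightarrow> real" and a b c T :: real
  assumes ab: "a \<le> b"
    and f': "\<And>x t. t \<in> {0..T} \<Longrightarrow> ((\<lambda>s. f x s) has_real_derivative ft x t) (at t within {0..T})"
    and contf: "continuous_on (UNIV \<times> {0..T}) (\<lambda>(x, t). f x t)"
    and contft: "continuous_on (UNIV \<times> {0..T}) (\<lambda>(x, t). ft x t)"
    and Z: "\<And>x t. t \<in> {0..T} \<Longrightarrow> ((\<lambda>y. Z y t) has_real_derivative z x t) (at x)"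
    and Z_ends: "\<And>t. t \<in> {0..T} \<Longrightarrow> Z b t = Z a t"
    and le: "\<And>x t. t \<in> {0..T} \<Longrightarrow> ft x t \<le> z x t + c * f x t"
    and t: "t \<in> {0..T}"
  shows "integral {a..b} (\<lambda>x. f x t) \<le> integral {a..b} (\<lambda>x. f x 0) * exp (c * t)"
proof -
  define F where "F t = integral {a..b} (\<lambda>x. f x t)" for t
  have row: "continuous_on {a..b} (\<lambda>x. h x s)"
    if "continuous_on (UNIV \<times> {0..T}) (\<lambda>(x, t). h x t)" "s \<in> {0..T}" for h :: "real \<Rightarrow> real \<Rightarrow> real" and s
    using continuous_on_compose2[OF that(1), of "{a..b}" "\<lambda>x. (x, s)"] that(2)
    by (auto simp: image_subset_iff continuous_on_Pair)
  have F': "(F has_real_derivative integral {a..b} (\<lambda>x. ft x s)) (at s within {0..T})"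
    if s: "s \<in> {0..T}" for s
  proof -
    have "((\<lambda>s. integral (cbox a b) (\<lambda>x. f x s)) has_real_derivative
        integral (cbox a b) (\<lambda>x. ft x s)) (at s within {0..T})"
    proof (rule leibniz_rule_field_derivative)
      show "(\<lambda>x. f x r) integrable_on cbox a b" if "r \<in> {0..T}" for r
        using row[OF contf that] by (simp add: integrable_continuous_real)
      have "continuous_on ({0..T} \<times> cbox a b) (\<lambda>p. (\<lambda>(x, t). ft x t) (snd p, fst p))"
        by (rule continuous_on_compose2[OF contft]) (auto intro!: continuous_intros)
      then show "continuous_on ({0..T} \<times> cbox a b) (\<lambda>(t, x). ft x t)"
        by (simp add: case_prod_beta')
    qed (use f' s in auto)
    then show ?thesis
      by (simp add: F_def[abs_def])
  qed
  have F'_le: "integral {a..b} (\<lambda>x. ft x s) \<le> c * F s" if s: "s \<in> {0..T}" for s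
  proof -
    \<comment> \<open>The fundamental theorem for the gauge integral yields integrability of z from
      Z alone; z is known only as a derivative, without continuity.\<close>
    have "((\<lambda>x. z x s) has_integral Z b s - Z a s) {a..b}"
      using Z[OF s] ab by (intro fundamental_theorem_of_calculus)
        (auto intro: has_vector_derivative_at_within
          simp: has_real_derivative_iff_has_vector_derivative[symmetric] has_field_derivative_at_within)
    then have z: "((\<lambda>x. z x s) has_integral 0) {a..b}"
      using Z_ends[OF s] by simp
    have f: "(\<lambda>x. f x s) integrable_on {a..b}"
      using row[OF contf s] by (rule integrable_continuous_real)
    have rhs: "((\<lambda>x. z x s + c * f x s) has_integral 0 + c * F s) {a..b}"
      using has_integral_add[OF z has_integral_mult_right[OF integrable_integral[OF f]]]
      by (simp add: F_def)
    have "integral {a..b} (\<lambda>x. ft x s) \<le> integral {a..b} (\<lambda>x. z x s + c * f x s)"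
      using le[OF s]
      by (intro integral_le integrable_continuous_real[OF row[OF contft s]] has_integral_integrable[OF rhs])
    then show ?thesis
      using integral_unique[OF rhs] by simp
  qed
  have "F t * exp (- c * t) \<le> F 0 * exp (- c * 0)"
  proof (rule DERIV_nonpos_imp_decreasing_open[of 0 t "\<lambda>s. F s * exp (- c * s)"])
    show "0 \<le> t" using t by simp
    show "continuous_on {0..t} (\<lambda>s. F s * exp (- c * s))"
    proof (intro continuous_intros)
      have "continuous_on {0..T} F"
        using F' by (intro has_derivative_continuous_on) (auto simp: has_field_derivative_def)
      then show "continuous_on {0..t} F"
        by (rule continuous_on_subset) (use t in auto)
    qed
    fix s assume s: "0 < s" "s < t"
    then have sT: "s \<in> {0..T}" using t by simp
    have "at s within {0..T} = at s"
      using s t by (simp add: at_within_Icc_at)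
    then have "(F has_real_derivative integral {a..b} (\<lambda>x. ft x s)) (at s)"
      using F'[OF sT] by simp
    then have "((\<lambda>s. F s * exp (- c * s)) has_real_derivative
        (integral {a..b} (\<lambda>x. ft x s) - c * F s) * exp (- c * s)) (at s)"
      by (auto intro!: derivative_eq_intros simp: algebra_simps)
    moreover have "(integral {a..b} (\<lambda>x. ft x s) - c * F s) * exp (- c * s) \<le> 0"
      using F'_le[OF sT] by (simp add: mult_nonpos_nonneg)
    ultimately show "\<exists>d. ((\<lambda>s. F s * exp (- c * s)) has_real_derivative d) (at s) \<and> d \<le> 0"
      by blast
  qed
  then show ?thesis
    by (simp add: F_def exp_minus field_simps)
qed

text \<open>Here \<open>p\<close> stands for \<open>\<partial>\<^sub>t|X|\<^sup>2\<close>, \<open>qx\<close> and \<open>qt\<close> for the derivatives of \<open>k\<^sup>2\<close>, \<open>w\<close> for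
  \<open>\<partial>\<^sub>x((k\<^sup>2)')\<close> and \<open>K\<close> for the regularisation \<open>sqrt (k\<^sup>2 + \<epsilon>\<^sup>2)\<close>. The gradient term produced by
  passing from \<open>k\<^sup>2\<close> to \<open>K\<close> is absorbed by \<open>- 2 N\<close>.\<close>

lemma regularised_evolution_bound:
  fixes v k K N p qx qt w C1 C2 :: real
  assumes v: "0 < v" and k: "0 \<le> k" and K: "k \<le> K" "0 < K" and C1: "0 \<le> C1" and N: "0 \<le> N"
    and qt: "qt \<le> w / v - 2 * N + 2 * k ^ 4 + 2 * C1 * (k\<^sup>2 + k)"
    and p: "p \<le> 2 * (C2 - k\<^sup>2) * v\<^sup>2"
    and qx: "qx\<^sup>2 \<le> 4 * v\<^sup>2 * k\<^sup>2 * N"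
  shows "qt / (2 * K) * v + (K + 1) * (p / (2 * v)) \<le>
    (w / (2 * K) - qx\<^sup>2 / (4 * v * K ^ 3)) + (C1 + C2) * ((K + 1) * v)"
proof -
  have kK2: "k\<^sup>2 \<le> K\<^sup>2" using k K by (intro power_mono)
  have "qt / (2 * K) * v \<le> (w / v - 2 * N + 2 * k ^ 4 + 2 * C1 * (k\<^sup>2 + k)) / (2 * K) * v"
    using qt v K by (intro mult_right_mono divide_right_mono) auto
  also have "\<dots> = w / (2 * K) - N * v / K + k ^ 4 / K * v + C1 * ((k\<^sup>2 + k) / K) * v"
    using v K by (simp add: field_simps)
  finally have 1: "qt / (2 * K) * v \<le>
      w / (2 * K) - N * v / K + k ^ 4 / K * v + C1 * ((k\<^sup>2 + k) / K) * v" .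
  \<comment> \<open>The resulting k^2 K v is cancelled in the final sum by the - k^2 K v of fact 4,
    the shrinking of the length element.\<close>
  have "k ^ 4 \<le> k\<^sup>2 * K * K"
    using mult_left_mono[OF kK2, of "k\<^sup>2"] by (simp add: power2_eq_square power4_eq_xxxx mult_ac)
  then have "k ^ 4 / K \<le> k\<^sup>2 * K"
    using K by (simp add: divide_le_eq)
  then have 2: "k ^ 4 / K * v \<le> k\<^sup>2 * K * v"
    using v by (intro mult_right_mono) auto
  \<comment> \<open>Division by K leaves K + 1: the 1 bounds k/K, and it is the reason for adding
    the length to the total curvature.\<close>
  have "k\<^sup>2 + k \<le> (K + 1) * K"
    using kK2 K by (simp add: power2_eq_square algebra_simps)
  then have "(k\<^sup>2 + k) / K \<le> K + 1"
    using K by (simp add: divide_le_eq)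
  then have 3: "C1 * ((k\<^sup>2 + k) / K) * v \<le> C1 * (K + 1) * v"
    using C1 v by (intro mult_right_mono mult_left_mono) auto
  have "p / (2 * v) \<le> (C2 - k\<^sup>2) * v"
    using p v by (simp add: divide_le_eq power2_eq_square mult_ac)
  then have "(K + 1) * (p / (2 * v)) \<le> (K + 1) * ((C2 - k\<^sup>2) * v)"
    using K by (intro mult_left_mono) auto
  then have 4: "(K + 1) * (p / (2 * v)) \<le> C2 * (K + 1) * v - k\<^sup>2 * K * v - k\<^sup>2 * v"
    by (simp add: algebra_simps)
  have "qx\<^sup>2 \<le> 4 * v\<^sup>2 * K\<^sup>2 * N"
    using qx mult_right_mono[OF kK2, of "4 * v\<^sup>2 * N"] N by (simp add: mult_ac)
  then have "qx\<^sup>2 / (4 * v * K ^ 3) \<le> 4 * v\<^sup>2 * K\<^sup>2 * N / (4 * v * K ^ 3)"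
    using v K by (intro divide_right_mono) auto
  also have "\<dots> = N * v / K"
    using v K by (simp add: field_simps power2_eq_square power3_eq_cube)
  finally have 5: "qx\<^sup>2 / (4 * v * K ^ 3) \<le> N * v / K" .
  have "0 \<le> k\<^sup>2 * v" using v by simp
  with 1 2 3 4 5 have "qt / (2 * K) * v + (K + 1) * (p / (2 * v)) \<le>
      w / (2 * K) - qx\<^sup>2 / (4 * v * K ^ 3) + C1 * (K + 1) * v + C2 * (K + 1) * v"
    by linarith
  then show ?thesis by (simp add: algebra_simps)
qed

context shrinking_flow
begin

abbreviation (input) "strip \<equiv> (UNIV :: real set) \<times> {0..T}"

abbreviation (input) "speed_sq \<equiv> \<lambda>(x, t). (speed A g c x t)\<^sup>2"

abbreviation (input) "curv_sq \<equiv> \<lambda>(x, t). (curv A g c x t)\<^sup>2"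

text \<open>From here on the estimates avoid coordinates: |X|^2 and k^2 are treated as smooth
  functions on the strip, with two-sided x-derivatives and one-sided t-derivatives.\<close>

lemma strip_derivatives:
  fixes F :: "real \<times> real \<Rightarrow> real"
  assumes F: "\<And>k. Ck_on k strip F"
  shows "\<And>k h. Ck_on k strip (\<lambda>z. dir_deriv strip F z h)"
    and "\<And>x t. t \<in> {0..T} \<Longrightarrow>
      ((\<lambda>y. F (y, t)) has_real_derivative dir_deriv strip F (x, t) (1, 0)) (at x)"
    and "\<And>x t. t \<in> {0..T} \<Longrightarrow>
      ((\<lambda>s. F (x, s)) has_real_derivative dir_deriv strip F (x, t) (0, 1)) (at t within {0..T})"
proof -
  have "thick strip"
    by (intro thick_Times thick_UNIV thick_interval T_pos)
  then show "Ck_on k strip (\<lambda>z. dir_deriv strip F z h)" for k h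
    using Ck_on_dir_deriv(1) F by blast
  have strip: "strip = (UNIV \<times> {0..T}) \<inter> UNIV" by simp
  show "((\<lambda>y. F (y, t)) has_real_derivative dir_deriv strip F (x, t) (1, 0)) (at x)"
    if "t \<in> {0..T}" for x t
    unfolding has_real_derivative_iff_has_vector_derivative
    using strip_partial_x[OF T_pos open_UNIV strip F] that by simp
  show "((\<lambda>s. F (x, s)) has_real_derivative dir_deriv strip F (x, t) (0, 1)) (at t within {0..T})"
    if "t \<in> {0..T}" for x t
    unfolding has_real_derivative_iff_has_vector_derivative
    using strip_partial_t[OF T_pos open_UNIV strip F] that by simp
qed

lemmas speed_sq_derivatives = strip_derivatives[OF speed_sq_smooth]
lemmas curv_sq_derivatives = strip_derivatives[OF curv_sq_smooth]

lemma continuous_on_strip: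
  "continuous_on strip (\<lambda>(x, t). speed A g c x t)"
  "continuous_on strip (\<lambda>(x, t). curv A g c x t)"
  "continuous_on strip (\<lambda>z. dir_deriv strip speed_sq z (0, 1))"
  "continuous_on strip (\<lambda>z. dir_deriv strip curv_sq z (0, 1))"
proof -
  have "continuous_on strip (\<lambda>z. sqrt (speed_sq z))"
    by (intro continuous_intros Ck_on_imp_continuous_on[OF speed_sq_smooth])
  then show "continuous_on strip (\<lambda>(x, t). speed A g c x t)"
    by (rule continuous_on_eq) (use speed_pos in \<open>auto simp: less_imp_le\<close>)
  have "continuous_on strip (\<lambda>z. sqrt (curv_sq z))"
    by (intro continuous_intros Ck_on_imp_continuous_on[OF curv_sq_smooth])
  then show "continuous_on strip (\<lambda>(x, t). curv A g c x t)"
    by (rule continuous_on_eq) (use curv_nonneg in auto)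
  show "continuous_on strip (\<lambda>z. dir_deriv strip speed_sq z (0, 1))"
    "continuous_on strip (\<lambda>z. dir_deriv strip curv_sq z (0, 1))"
    using Ck_on_imp_continuous_on speed_sq_derivatives(1) curv_sq_derivatives(1) by blast+
qed

lemma row_continuous:
  assumes "continuous_on strip (\<lambda>(x, t). h x t :: real)" "t \<in> {0..T}"
  shows "continuous_on R (\<lambda>x. h x t)"
  using continuous_on_compose2[OF assms(1), of R "\<lambda>x. (x, t)"] assms(2)
  by (auto simp: image_subset_iff continuous_on_Pair)

section \<open>The length estimate\<close>

lemma speed_t:
  assumes t: "t \<in> {0..T}"
  shows "((\<lambda>s. speed A g c x s) has_real_derivative
    dir_deriv strip speed_sq (x, t) (0, 1) / (2 * speed A g c x t)) (at t within {0..T})"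
proof -
  have "((\<lambda>s. sqrt ((speed A g c x s)\<^sup>2)) has_real_derivative
      dir_deriv strip speed_sq (x, t) (0, 1) / (2 * sqrt ((speed A g c x t)\<^sup>2))) (at t within {0..T})"
    using sqrt_has_real_derivative[OF speed_sq_derivatives(3)[OF t, of x]] speed_pos[OF t, of x]
    by simp
  then show ?thesis
    unfolding real_sqrt_abs abs_of_pos[OF speed_pos[OF t]]
    by (rule has_field_derivative_transform_within[where d = 1])
      (use speed_pos[of _ x] t in \<open>auto simp: abs_of_pos\<close>)
qed

lemma speed_sq_t_le:
  assumes "ricci_norm_bound A {0..T} g C2" "t \<in> {0..T}"
  shows "dir_deriv strip speed_sq (x, t) (0, 1) \<le> 2 * (C2 - (curv A g c x t)\<^sup>2) * (speed A g c x t)\<^sup>2"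
proof -
  obtain d where d: "((\<lambda>s. (speed A g c x s)\<^sup>2) has_real_derivative d) (at t within {0..T})"
    "d \<le> 2 * (C2 - (curv A g c x t)\<^sup>2) * (speed A g c x t)\<^sup>2"
    using speed_sq_evolution[OF assms] by blast
  have "dir_deriv strip speed_sq (x, t) (0, 1) = d"
    using vector_derivative_unique_within[OF at_within_interval_neq_bot[OF T_pos assms(2)]]
      d(1) speed_sq_derivatives(3)[OF assms(2), of x]
    unfolding has_real_derivative_iff_has_vector_derivative by simp
  then show ?thesis using d(2) by simp
qed

lemma length_bound:
  assumes C2: "ricci_norm_bound A {0..T} g C2" and t: "t \<in> {0..T}"
  shows "curve_length A g c t \<le> curve_length A g c 0 * exp (C2 * t)"
  unfolding curve_length_def
\<comment> \<open>The bound \<partial>_t |X| \<le> C2 |X| holds pointwise, so Z and z are taken to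
  be zero.\<close>
proof (rule integral_Gronwall[where ft = "\<lambda>x t. dir_deriv strip speed_sq (x, t) (0, 1) / (2 * speed A g c x t)"
      and T = T and Z = "\<lambda>_ _. 0" and z = "\<lambda>_ _. 0"])
  have "continuous_on strip (\<lambda>z. dir_deriv strip speed_sq z (0, 1) / (2 * (case z of (x, t) \<Rightarrow> speed A g c x t)))"
    using speed_pos by (intro continuous_intros continuous_on_strip) (auto simp: less_imp_neq[symmetric])
  then show "continuous_on strip (\<lambda>(x, t). dir_deriv strip speed_sq (x, t) (0, 1) / (2 * speed A g c x t))"
    by (simp add: case_prod_beta')
  fix x s assume s: "s \<in> {0..T}"
  have "dir_deriv strip speed_sq (x, s) (0, 1) \<le> 2 * (C2 - (curv A g c x s)\<^sup>2) * (speed A g c x s)\<^sup>2"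
    by (rule speed_sq_t_le[OF C2 s])
  also have "\<dots> \<le> 2 * C2 * (speed A g c x s)\<^sup>2"
    by (intro mult_right_mono) auto
  finally show "dir_deriv strip speed_sq (x, s) (0, 1) / (2 * speed A g c x s) \<le> 0 + C2 * speed A g c x s"
    using speed_pos[OF s, of x] by (simp add: divide_le_eq power2_eq_square mult_ac)
qed (use speed_t continuous_on_strip(1) t in \<open>auto\<close>)

section \<open>Regularised total curvature\<close>

definition reg_curv :: "real \<Rightarrow> real \<Rightarrow> real \<Rightarrow> real" where
  "reg_curv \<epsilon> x t = sqrt ((curv A g c x t)\<^sup>2 + \<epsilon>\<^sup>2)"

context
  fixes \<epsilon> :: real
  assumes \<epsilon>: "0 < \<epsilon>"
begin

lemma reg_curv_pos: "0 < reg_curv \<epsilon> x t"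
  unfolding reg_curv_def using \<epsilon> by (simp add: add_nonneg_pos)

lemma reg_curv_bounds:
  assumes "t \<in> {0..T}"
  shows "curv A g c x t \<le> reg_curv \<epsilon> x t" "reg_curv \<epsilon> x t \<le> curv A g c x t + \<epsilon>"
  unfolding reg_curv_def using curv_nonneg[OF assms, of x] \<epsilon>
  by (auto intro!: real_le_rsqrt real_le_lsqrt simp: power2_sum)

lemma reg_curv_continuous: "continuous_on strip (\<lambda>(x, t). reg_curv \<epsilon> x t)"
proof -
  have "continuous_on strip (\<lambda>z. sqrt (curv_sq z + \<epsilon>\<^sup>2))"
    by (intro continuous_intros Ck_on_imp_continuous_on[OF curv_sq_smooth])
  then show ?thesis by (simp add: reg_curv_def case_prod_beta')
qed

lemma reg_curv_t:
  assumes t: "t \<in> {0..T}"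
  shows "((\<lambda>s. reg_curv \<epsilon> x s) has_real_derivative
    dir_deriv strip curv_sq (x, t) (0, 1) / (2 * reg_curv \<epsilon> x t)) (at t within {0..T})"
  using sqrt_has_real_derivative[OF DERIV_add[OF curv_sq_derivatives(3)[OF t, of x] DERIV_const],
      of "\<epsilon>\<^sup>2"] \<epsilon>
  unfolding reg_curv_def by (simp add: add_nonneg_pos)

lemma reg_curv_x:
  assumes t: "t \<in> {0..T}"
  shows "((\<lambda>y. reg_curv \<epsilon> y t) has_real_derivative
    dir_deriv strip curv_sq (x, t) (1, 0) / (2 * reg_curv \<epsilon> x t)) (at x)"
  using sqrt_has_real_derivative[OF DERIV_add[OF curv_sq_derivatives(2)[OF t, of x] DERIV_const],
      of "\<epsilon>\<^sup>2"] \<epsilon>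
  unfolding reg_curv_def by (simp add: add_nonneg_pos)

lemma arc_deriv_curv_sq:
  assumes t: "t \<in> {0..T}"
  shows "arc_deriv A g c (\<lambda>y s. (curv A g c y s)\<^sup>2) x t =
    dir_deriv strip curv_sq (x, t) (1, 0) / speed A g c x t"
  using vector_derivative_at[OF curv_sq_derivatives(2)[OF t, of x,
      unfolded has_real_derivative_iff_has_vector_derivative]]
  by (simp add: arc_deriv_def)

text \<open>\<open>arc_deriv\<close> is defined through \<open>vector_derivative\<close>, which is
  meaningful only for differentiable functions. Here (k^2)' is shown to be differentiable, so the
  second arc derivative in the assumption on Chat is genuine, and its product with |X| is an exact
  x-derivative.\<close>

lemma arc_deriv_curv_sq_x:
  assumes t: "t \<in> {0..T}"
  shows "((\<lambda>y. dir_deriv strip curv_sq (y, t) (1, 0) / speed A g c y t) has_real_derivative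
    arc_deriv A g c (arc_deriv A g c (\<lambda>y s. (curv A g c y s)\<^sup>2)) x t * speed A g c x t) (at x)"
proof -
  let ?w = "\<lambda>y. dir_deriv strip curv_sq (y, t) (1, 0) / speed A g c y t"
  have "((\<lambda>y. sqrt ((speed A g c y t)\<^sup>2)) has_real_derivative
      dir_deriv strip speed_sq (x, t) (1, 0) / (2 * sqrt ((speed A g c x t)\<^sup>2))) (at x)"
    using sqrt_has_real_derivative[OF speed_sq_derivatives(2)[OF t, of x]] speed_pos[OF t, of x]
    by simp
  moreover have "sqrt ((speed A g c y t)\<^sup>2) = speed A g c y t" for y
    using speed_pos[OF t, of y] by simp
  ultimately have v: "((\<lambda>y. speed A g c y t) has_real_derivative
      dir_deriv strip speed_sq (x, t) (1, 0) / (2 * speed A g c x t)) (at x)"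
    by simp
  have q: "((\<lambda>y. dir_deriv strip curv_sq (y, t) (1, 0)) has_real_derivative
      dir_deriv strip (\<lambda>z. dir_deriv strip curv_sq z (1, 0)) (x, t) (1, 0)) (at x)"
    by (rule strip_derivatives(2)[OF curv_sq_derivatives(1) t])
  obtain w' where w': "(?w has_real_derivative w') (at x)"
    using DERIV_divide[OF q v] speed_pos[OF t, of x] by auto
  then have "vector_derivative ?w (at x) = w'"
    unfolding has_real_derivative_iff_has_vector_derivative by (rule vector_derivative_at)
  then have "arc_deriv A g c (arc_deriv A g c (\<lambda>y s. (curv A g c y s)\<^sup>2)) x t = w' / speed A g c x t"
    unfolding arc_deriv_def[of A g c "arc_deriv A g c (\<lambda>y s. (curv A g c y s)\<^sup>2)"]
      arc_deriv_curv_sq[OF t] by simp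
  then show ?thesis
    using w' speed_pos[OF t, of x] by simp
qed

lemma curv_sq_x_periodic:
  assumes t: "t \<in> {0..T}"
  shows "dir_deriv strip curv_sq (x + 2 * pi, t) (1, 0) = dir_deriv strip curv_sq (x, t) (1, 0)"
proof -
  have "((\<lambda>y. (curv A g c y t)\<^sup>2) has_vector_derivative dir_deriv strip curv_sq (x, t) (1, 0))
      (at (x + 2 * pi))"
    by (rule has_vector_derivative_periodic)
      (use curv_sq_derivatives(2)[OF t, of x] curv_periodic[OF t] in
        \<open>auto simp: has_real_derivative_iff_has_vector_derivative\<close>)
  then have "((\<lambda>y. (curv A g c y t)\<^sup>2) has_real_derivative dir_deriv strip curv_sq (x, t) (1, 0))
      (at (x + 2 * pi))"
    unfolding has_real_derivative_iff_has_vector_derivative .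
  moreover have "((\<lambda>y. (curv A g c y t)\<^sup>2) has_real_derivative
      dir_deriv strip curv_sq (x + 2 * pi, t) (1, 0)) (at (x + 2 * pi))"
    using curv_sq_derivatives(2)[OF t, of "x + 2 * pi"] by simp
  ultimately show ?thesis
    by (rule DERIV_unique[symmetric])
qed

text \<open>The evolution constant appears as 2 C1 because \<partial>_t K is \<partial>_t (k^2)
  divided by 2 K.\<close>

lemma regularised_bound:
  assumes C2: "ricci_norm_bound A {0..T} g C2"
    and C1: "0 \<le> C1" "curvature_evolution_constant A {0..T} g (2 * C1)"
    and t: "t \<in> {0..T}"
  shows "integral {0..2 * pi} (\<lambda>x. (reg_curv \<epsilon> x t + 1) * speed A g c x t) \<le>
    integral {0..2 * pi} (\<lambda>x. (reg_curv \<epsilon> x 0 + 1) * speed A g c x 0) * exp ((C1 + C2) * t)"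
proof -
  let ?v = "speed A g c" and ?k = "curv A g c" and ?K = "reg_curv \<epsilon>"
  define p where "p x t = dir_deriv strip speed_sq (x, t) (0, 1)" for x t
  define qt where "qt x t = dir_deriv strip curv_sq (x, t) (0, 1)" for x t
  define qx where "qx x t = dir_deriv strip curv_sq (x, t) (1, 0)" for x t
  define w where "w x t = arc_deriv A g c (arc_deriv A g c (\<lambda>y s. (?k y s)\<^sup>2)) x t * ?v x t" for x t
  show ?thesis
  \<comment> \<open>Z is the arc derivative K' = (k^2)' / (2 K), and z = \<partial>_x Z is K'' |X|.
    The negative part of z comes from differentiating K in the denominator; it is the term that the
    gradient of H has to absorb.\<close>
  proof (rule integral_Gronwall[where T = T and Z = "\<lambda>x t. qx x t / ?v x t / (2 * ?K x t)"
        and ft = "\<lambda>x t. qt x t / (2 * ?K x t) * ?v x t + (?K x t + 1) * (p x t / (2 * ?v x t))"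
        and z = "\<lambda>x t. w x t / (2 * ?K x t) - (qx x t)\<^sup>2 / (4 * ?v x t * ?K x t ^ 3)"])
    fix x s assume s: "s \<in> {0..T}"
    note pos = speed_pos[OF s, of x] reg_curv_pos[of x s]
    have "((\<lambda>s. (?K x s + 1) * ?v x s) has_real_derivative
        (qt x s / (2 * ?K x s) + 0) * ?v x s + p x s / (2 * ?v x s) * (?K x s + 1)) (at s within {0..T})"
      unfolding qt_def p_def
      by (intro DERIV_mult DERIV_add DERIV_const reg_curv_t[OF s] speed_t[OF s])
    then show "((\<lambda>s. (?K x s + 1) * ?v x s) has_real_derivative
        qt x s / (2 * ?K x s) * ?v x s + (?K x s + 1) * (p x s / (2 * ?v x s))) (at s within {0..T})"
      by (simp add: mult.commute)
    have "((\<lambda>y. qx y s / ?v y s / (2 * ?K y s)) has_real_derivative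
        (w x s * (2 * ?K x s) - qx x s / ?v x s * (2 * (qx x s / (2 * ?K x s)))) /
          ((2 * ?K x s) * (2 * ?K x s))) (at x)"
      unfolding w_def qx_def
      by (intro DERIV_divide DERIV_cmult arc_deriv_curv_sq_x[OF s] reg_curv_x[OF s]) (use pos in simp)
    moreover have "(w x s * (2 * ?K x s) - qx x s / ?v x s * (2 * (qx x s / (2 * ?K x s)))) /
        ((2 * ?K x s) * (2 * ?K x s)) =
        w x s / (2 * ?K x s) - (qx x s)\<^sup>2 / (4 * ?v x s * ?K x s ^ 3)"
      using pos by (simp add: field_simps power2_eq_square power3_eq_cube)
    ultimately show "((\<lambda>y. qx y s / ?v y s / (2 * ?K y s)) has_real_derivative
        w x s / (2 * ?K x s) - (qx x s)\<^sup>2 / (4 * ?v x s * ?K x s ^ 3)) (at x)"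
      by simp
    have "vector_derivative (\<lambda>s. (?k x s)\<^sup>2) (at s within {0..T}) = qt x s"
      unfolding qt_def using curv_sq_derivatives(3)[OF s, of x]
      by (intro vector_derivative_within[OF at_within_interval_neq_bot[OF T_pos s]])
        (simp add: has_real_derivative_iff_has_vector_derivative)
    then have "qt x s \<le> w x s / ?v x s - 2 * nabla_S_H_perp_sq A {0..T} g c x s + 2 * ?k x s ^ 4
        + 2 * C1 * ((?k x s)\<^sup>2 + ?k x s)"
      using C1(2)[unfolded curvature_evolution_constant_def, rule_format, OF shrinking s, of x] pos(1)
      unfolding w_def by simp
    moreover have "(qx x s)\<^sup>2 \<le> 4 * (?v x s)\<^sup>2 * (?k x s)\<^sup>2 * nabla_S_H_perp_sq A {0..T} g c x s"
      "0 \<le> nabla_S_H_perp_sq A {0..T} g c x s"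
      using curv_sq_gradient[OF s, of _ x] curv_sq_derivatives(2)[OF s, of x] unfolding qx_def by simp_all
    ultimately show "qt x s / (2 * ?K x s) * ?v x s + (?K x s + 1) * (p x s / (2 * ?v x s)) \<le>
        w x s / (2 * ?K x s) - (qx x s)\<^sup>2 / (4 * ?v x s * ?K x s ^ 3) + (C1 + C2) * ((?K x s + 1) * ?v x s)"
      using speed_sq_t_le[OF C2 s, of x] curv_nonneg[OF s, of x] reg_curv_bounds(1)[OF s, of x] C1(1) pos
      unfolding p_def by (intro regularised_evolution_bound)
  next
    fix s assume s: "s \<in> {0..T}"
    show "qx (2 * pi) s / ?v (2 * pi) s / (2 * ?K (2 * pi) s) = qx 0 s / ?v 0 s / (2 * ?K 0 s)"
      using curv_sq_x_periodic[OF s, of 0] speed_periodic[OF s, of 0] curv_periodic[OF s, of 0]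
      by (simp add: qx_def reg_curv_def)
  next
    have "continuous_on strip (\<lambda>z. ((\<lambda>(x, t). ?K x t) z + 1) * (\<lambda>(x, t). ?v x t) z)"
      by (intro continuous_intros continuous_on_strip reg_curv_continuous)
    then show "continuous_on strip (\<lambda>(x, t). (?K x t + 1) * ?v x t)"
      by (simp add: case_prod_beta')
    have "continuous_on strip (\<lambda>z. dir_deriv strip curv_sq z (0, 1) / (2 * (\<lambda>(x, t). ?K x t) z) *
        (\<lambda>(x, t). ?v x t) z + ((\<lambda>(x, t). ?K x t) z + 1) *
        (dir_deriv strip speed_sq z (0, 1) / (2 * (\<lambda>(x, t). ?v x t) z)))"
      using speed_pos reg_curv_pos
      by (intro continuous_intros continuous_on_strip reg_curv_continuous)
        (auto simp: less_imp_neq[symmetric])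
    then show "continuous_on strip (\<lambda>(x, t). qt x t / (2 * ?K x t) * ?v x t +
        (?K x t + 1) * (p x t / (2 * ?v x t)))"
      by (simp add: case_prod_beta' qt_def p_def)
  qed (use t in auto)
qed

end

section \<open>Removing the regularisation\<close>

lemma total_curvature_length:
  assumes t: "t \<in> {0..T}"
  shows "(\<lambda>x. speed A g c x t) integrable_on {0..2 * pi}"
    and "(\<lambda>x. curv A g c x t * speed A g c x t) integrable_on {0..2 * pi}"
    and "total_curvature A g c t + curve_length A g c t =
      integral {0..2 * pi} (\<lambda>x. (curv A g c x t + 1) * speed A g c x t)"
    and "0 \<le> curve_length A g c t"
proof -
  note cont = row_continuous[OF continuous_on_strip(1) t] row_continuous[OF continuous_on_strip(2) t]
  show int: "(\<lambda>x. speed A g c x t) integrable_on {0..2 * pi}"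
    "(\<lambda>x. curv A g c x t * speed A g c x t) integrable_on {0..2 * pi}"
    by (intro integrable_continuous_real continuous_on_mult cont)+
  show "total_curvature A g c t + curve_length A g c t =
      integral {0..2 * pi} (\<lambda>x. (curv A g c x t + 1) * speed A g c x t)"
    unfolding total_curvature_def curve_length_def integral_add[OF int(2,1), symmetric]
    by (simp add: algebra_simps)
  show "0 \<le> curve_length A g c t"
    unfolding curve_length_def using speed_pos[OF t]
    by (intro integral_nonneg int) (simp add: less_imp_le)
qed

text \<open>At time t the bound k \<le> K suffices. At time 0 the opposite bound K \<le> k +
  \<epsilon> costs at most \<epsilon> L(0), which vanishes in the limit because the exponential
  factor does not depend on \<epsilon>.\<close>

lemma total_curvature_length_bound:
  assumes C2: "ricci_norm_bound A {0..T} g C2"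
    and C1: "0 \<le> C1" "curvature_evolution_constant A {0..T} g (2 * C1)"
    and t: "t \<in> {0..T}"
  shows "total_curvature A g c t + curve_length A g c t \<le>
    (total_curvature A g c 0 + curve_length A g c 0) * exp ((C1 + C2) * t)"
proof -
  let ?E = "exp ((C1 + C2) * t)" and ?L = "curve_length A g c"
  let ?TL = "\<lambda>t. total_curvature A g c t + ?L t"
  have t0: "0 \<in> {0..T}" using T_pos by simp
  have reg_integrable: "(\<lambda>x. (reg_curv \<epsilon> x s + 1) * speed A g c x s) integrable_on {0..2 * pi}"
    if "0 < \<epsilon>" "s \<in> {0..T}" for \<epsilon> s
    by (intro integrable_continuous_real continuous_on_mult continuous_on_add continuous_on_const
        row_continuous[OF continuous_on_strip(1) that(2)]
        row_continuous[OF reg_curv_continuous[OF that(1)] that(2)])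
  have integrable: "(\<lambda>x. (curv A g c x s + 1) * speed A g c x s) integrable_on {0..2 * pi}"
    if "s \<in> {0..T}" for s
    using integrable_add[OF total_curvature_length(2,1)[OF that]] by (simp add: algebra_simps)
  have approx: "?TL t \<le> (?TL 0 + \<epsilon> * ?L 0) * ?E" if \<epsilon>: "0 < \<epsilon>" for \<epsilon>
  proof -
    have "?TL t \<le> integral {0..2 * pi} (\<lambda>x. (reg_curv \<epsilon> x t + 1) * speed A g c x t)"
      unfolding total_curvature_length(3)[OF t]
      using reg_curv_bounds(1)[OF \<epsilon> t] speed_pos[OF t]
      by (intro integral_le integrable reg_integrable \<epsilon> t mult_right_mono) (auto simp: less_imp_le)
    also have "\<dots> \<le> integral {0..2 * pi} (\<lambda>x. (reg_curv \<epsilon> x 0 + 1) * speed A g c x 0) * ?E"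
      by (rule regularised_bound[OF \<epsilon> C2 C1 t])
    also have "integral {0..2 * pi} (\<lambda>x. (reg_curv \<epsilon> x 0 + 1) * speed A g c x 0) \<le>
        integral {0..2 * pi} (\<lambda>x. (curv A g c x 0 + 1) * speed A g c x 0 + \<epsilon> * speed A g c x 0)"
    proof (intro integral_le reg_integrable integrable_add integrable integrable_on_mult_right
        total_curvature_length(1) \<epsilon> t0)
      fix x
      have "(reg_curv \<epsilon> x 0 + 1) * speed A g c x 0 \<le> (curv A g c x 0 + \<epsilon> + 1) * speed A g c x 0"
        using reg_curv_bounds(2)[OF \<epsilon> t0, of x] speed_pos[OF t0, of x]
        by (intro mult_right_mono) auto
      then show "(reg_curv \<epsilon> x 0 + 1) * speed A g c x 0 \<le>
          (curv A g c x 0 + 1) * speed A g c x 0 + \<epsilon> * speed A g c x 0"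
        by (simp add: algebra_simps)
    qed
    also have "\<dots> = ?TL 0 + \<epsilon> * ?L 0"
      by (subst integral_add)
        (simp_all add: integrable[OF t0] total_curvature_length(1)[OF t0] integrable_on_mult_right
          total_curvature_length(3)[OF t0, symmetric] curve_length_def[symmetric])
    finally show ?thesis by simp
  qed
  have "((\<lambda>\<epsilon>. (?TL 0 + \<epsilon> * ?L 0) * ?E) \<longlongrightarrow> (?TL 0 + 0 * ?L 0) * ?E) (at_right 0)"
    by (intro tendsto_intros)
  moreover have "eventually (\<lambda>\<epsilon>. ?TL t \<le> (?TL 0 + \<epsilon> * ?L 0) * ?E) (at_right 0)"
    using approx by (auto simp: eventually_at_right_field intro: exI[of _ 1])
  ultimately have "?TL t \<le> (?TL 0 + 0 * ?L 0) * ?E"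
    by (rule tendsto_lowerbound) simp
  then show ?thesis by simp
qed

end

theorem mainTheorem4:
  fixes A :: "('m::t2_space, 'e::euclidean_space) chart set"
    and T Chat C1 C2 :: real
    and g :: "('m, 'e) metrics"
    and c :: "real \<Rightarrow> real \<Rightarrow> 'm"
  assumes "compact (UNIV :: 'm set)" and "smooth_atlas A"
    and "0 < T"
    and "ricci_flow A {0..T} g"
    and "0 \<le> Chat" and "curvature_evolution_constant A {0..T} g Chat"
    and "C1 = Chat / 2"
    and "ricci_norm_bound A {0..T} g C2"
    and "curve_shrinking_flow A {0..T} g c"
  shows "\<forall>t\<in>{0..T}.
      curve_length A g c t \<le> curve_length A g c 0 * exp (C2 * t) \<and>
      total_curvature A g c t \<le> total_curvature A g c t + curve_length A g c t \<and>
      total_curvature A g c t + curve_length A g c t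
        \<le> (total_curvature A g c 0 + curve_length A g c 0) * exp ((C1 + C2) * t)"
proof -
  interpret shrinking_flow A T g c
    using assms(2-4,9) by unfold_locales
  have C1: "0 \<le> C1" "curvature_evolution_constant A {0..T} g (2 * C1)"
    using assms(5,6) unfolding assms(7) by simp_all
  \<comment> \<open>The middle inequality is the nonnegativity of the length.\<close>
  show ?thesis
    using length_bound[OF assms(8)] total_curvature_length(4)
      total_curvature_length_bound[OF assms(8) C1] by simp
qed

end
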